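(* Non-termination and boundedness are decidable for input-bounded FIFO machines: for an input-bounded FIFO machine, it is decidable whether there is an infinite run from the initial state $(q_0,\varepsilon)$, and whether the set of states reachable from $(q_0,\varepsilon)$ is finite.
   Context: A FIFO machine over a finite set of channels $\mathsf{Ch}$ is $\mathcal{M}=(Q,A,T,q_0)$ with finite control states $Q$, finite message alphabet $A$, initial control-state $q_0$, and $T\subseteq Q\times\mathsf{Ch}\times\{!,?\}\times A\times Q$. States are $(q,\mathbf{w})$ with $\mathbf{w}\in(A^* )^{\mathsf{Ch}}$ the channel contents, initial state $(q_0,\varepsilon)$ (all channels empty); $(q,\mathbf{w})\xrightarrow{c!a}(q',\mathbf{w}')$ if $(q,c!a,q')\in T$, $\mathbf{w}'_c=\mathbf{w}_ca$, other channels unchanged; $(q,\mathbf{w})\xrightarrow{c?a}(q',\mathbf{w}')$ if $(q,c?a,q')\in T$, $\mathbf{w}_c=a\mathbf{w}'_c$, other channels unchanged. Traces are action words executable from $(q_0,\varepsilon)$. For a channel $c$, $\pi_{c!}$ maps $c!a$ to $a$ and every other action to $\varepsilon$. $\mathcal{M}$ is input-bounded if for each channel $c$ there is a bounded regular language $L_c=w_1^*\cdots w_n^*$ ($w_i\in A^*$) such that $\pi_{c!}(\sigma)$ is a prefix of a word in $L_c$ for every trace $\sigma$. *)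

theory Defs
  imports Main "HOL-Library.Nat_Bijection" "HOL-Library.Sublist"
begin

section \<open>FIFO machines\<close>

datatype dir = Send | Receive

type_synonym ('c, 'a) action = "'c \<times> dir \<times> 'a"

record ('q, 'c, 'a) fifo_machine =
  control_states :: "'q set"
  channels :: "'c set"
  alphabet :: "'a set"
  transitions :: "('q \<times> ('c, 'a) action \<times> 'q) set"
  initial_control :: 'q

definition wf_fifo_machine :: "('q, 'c, 'a) fifo_machine \<Rightarrow> bool" where
  "wf_fifo_machine M \<longleftrightarrow>
     finite (control_states M) \<and> finite (channels M) \<and> finite (alphabet M) \<and>
     transitions M \<subseteq> control_states M \<times> (channels M \<times> UNIV \<times> alphabet M) \<times> control_states M \<and>
     initial_control M \<in> control_states M"

text \<open>
  Channel contents are total functions on the type of channels. In a well-formed machine no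
  transition touches anything outside \<open>channels M\<close>, so such components stay empty in every
  configuration reachable from the initial one.
\<close>

type_synonym ('q, 'c, 'a) config = "'q \<times> ('c \<Rightarrow> 'a list)"

definition initial_config :: "('q, 'c, 'a) fifo_machine \<Rightarrow> ('q, 'c, 'a) config" where
  "initial_config M = (initial_control M, \<lambda>_. [])"

inductive step ::
  "('q, 'c, 'a) fifo_machine \<Rightarrow> ('q, 'c, 'a) config \<Rightarrow> ('c, 'a) action \<Rightarrow> ('q, 'c, 'a) config \<Rightarrow> bool"
  for M where
  send: "(q, (c, Send, a), q') \<in> transitions M \<Longrightarrow>
         step M (q, w) (c, Send, a) (q', w(c := w c @ [a]))"
| receive: "(q, (c, Receive, a), q') \<in> transitions M \<Longrightarrow> w c = a # v \<Longrightarrow>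
         step M (q, w) (c, Receive, a) (q', w(c := v))"

inductive steps ::
  "('q, 'c, 'a) fifo_machine \<Rightarrow> ('q, 'c, 'a) config \<Rightarrow> ('c, 'a) action list \<Rightarrow> ('q, 'c, 'a) config \<Rightarrow> bool"
  for M where
  Nil: "steps M s [] s"
| Cons: "step M s \<alpha> s' \<Longrightarrow> steps M s' \<sigma> s'' \<Longrightarrow> steps M s (\<alpha> # \<sigma>) s''"

definition traces :: "('q, 'c, 'a) fifo_machine \<Rightarrow> ('c, 'a) action list set" where
  "traces M = {\<sigma>. \<exists>s. steps M (initial_config M) \<sigma> s}"

definition reachable :: "('q, 'c, 'a) fifo_machine \<Rightarrow> ('q, 'c, 'a) config set" where
  "reachable M = {s. \<exists>\<sigma>. steps M (initial_config M) \<sigma> s}"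

definition nonterminating :: "('q, 'c, 'a) fifo_machine \<Rightarrow> bool" where
  "nonterminating M \<longleftrightarrow>
     (\<exists>s \<alpha>. s 0 = initial_config M \<and> (\<forall>i::nat. step M (s i) (\<alpha> i) (s (Suc i))))"

definition bounded_machine :: "('q, 'c, 'a) fifo_machine \<Rightarrow> bool" where
  "bounded_machine M \<longleftrightarrow> finite (reachable M)"


section \<open>Input-boundedness\<close>

definition send_proj :: "'c \<Rightarrow> ('c, 'a) action list \<Rightarrow> 'a list" where
  "send_proj c \<sigma> = concat (map (\<lambda>(c', d, a). if c' = c \<and> d = Send then [a] else []) \<sigma>)"

text \<open>\<open>bounded_lang [w1, ..., wn]\<close> is the language \<open>w1* ... wn*\<close>.\<close>

fun bounded_lang :: "'a list list \<Rightarrow> 'a list set" where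
  "bounded_lang [] = {[]}"
| "bounded_lang (w # ws) = {concat (replicate k w) @ v | k v. v \<in> bounded_lang ws}"

definition input_bounded :: "('q, 'c, 'a) fifo_machine \<Rightarrow> bool" where
  "input_bounded M \<longleftrightarrow>
     (\<forall>c \<in> channels M. \<exists>ws. set ws \<subseteq> lists (alphabet M) \<and>
        (\<forall>\<sigma> \<in> traces M. \<exists>u \<in> bounded_lang ws. prefix (send_proj c \<sigma>) u))"


section \<open>Partial recursive functions and decidability\<close>

datatype recf =
    Zero | Succ | Proj nat | Comp recf "recf list" | PrimRec recf recf | Mu recf

text \<open>
  \<open>rec_eval f xs y\<close>: the partial recursive function \<open>f\<close> is defined on the argument list \<open>xs\<close> and
  has value \<open>y\<close> there. The recursion and minimisation argument comes first; the step function of a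
  primitive recursion receives the previous value, the counter and the parameters.
\<close>

inductive rec_eval :: "recf \<Rightarrow> nat list \<Rightarrow> nat \<Rightarrow> bool" where
  zero: "rec_eval Zero xs 0"
| succ: "rec_eval Succ [x] (Suc x)"
| proj: "i < length xs \<Longrightarrow> rec_eval (Proj i) xs (xs ! i)"
| comp: "length ys = length gs \<Longrightarrow> (\<forall>i < length gs. rec_eval (gs ! i) xs (ys ! i)) \<Longrightarrow>
         rec_eval f ys z \<Longrightarrow> rec_eval (Comp f gs) xs z"
| primrec_0: "rec_eval f xs y \<Longrightarrow> rec_eval (PrimRec f g) (0 # xs) y"
| primrec_Suc: "rec_eval (PrimRec f g) (n # xs) y \<Longrightarrow> rec_eval g (y # n # xs) z \<Longrightarrow>
         rec_eval (PrimRec f g) (Suc n # xs) z"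
| mu: "rec_eval f (n # xs) 0 \<Longrightarrow> (\<forall>m < n. \<exists>y. rec_eval f (m # xs) (Suc y)) \<Longrightarrow>
         rec_eval (Mu f) xs n"

lemma rec_eval_deterministic:
  "rec_eval f xs y \<Longrightarrow> rec_eval f xs z \<Longrightarrow> y = z"
proof (induction arbitrary: z rule: rec_eval.induct)
  case (zero xs)
  then show ?case by cases simp
next
  case (succ x)
  then show ?case by cases simp
next
  case (proj i xs)
  from proj.prems show ?case by cases simp
next
  case (comp ys gs xs f y)
  from comp.prems obtain ys' where ys': "length ys' = length gs"
    "\<forall>i < length gs. rec_eval (gs ! i) xs (ys' ! i)" "rec_eval f ys' z"
    by cases (rule that)
  have "ys = ys'"
  proof (rule nth_equalityI)
    show "length ys = length ys'" using comp.hyps(1) ys'(1) by (rule trans[OF _ sym])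
    show "ys ! i = ys' ! i" if "i < length ys" for i
      using comp.IH(1) ys'(2) that[unfolded comp.hyps(1)] by blast
  qed
  with ys'(3) show ?case using comp.IH(2) by blast
next
  case (primrec_0 f xs y g)
  from primrec_0.prems have "rec_eval f xs z" by cases simp
  then show ?case by (rule primrec_0.IH)
next
  case (primrec_Suc f g n xs y z z')
  from primrec_Suc.prems obtain y' where
    y': "rec_eval (PrimRec f g) (n # xs) y'" "rec_eval g (y' # n # xs) z'"
    by cases (rule that)
  from y'(1) have "y = y'" by (rule primrec_Suc.IH(1))
  with y'(2) show ?case using primrec_Suc.IH(2) by blast
next
  case (mu f n xs z)
  from mu.prems have z: "rec_eval f (z # xs) 0 \<and> (\<forall>m < z. \<exists>y. rec_eval f (m # xs) (Suc y))"
    by cases (rule conjI)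
  show ?case
  proof (rule linorder_cases[of n z])
    assume "n < z"
    then obtain y where "rec_eval f (n # xs) (Suc y)" using z by blast
    then have "0 = Suc y" by (rule mu.IH(1))
    then show ?thesis by simp
  next
    assume "z < n"
    then obtain y where "\<forall>v. rec_eval f (z # xs) v \<longrightarrow> Suc y = v" using mu.IH(2) by blast
    then have "Suc y = 0" using z by blast
    then show ?thesis by simp
  qed
qed

text \<open>
  Decidability of a property \<open>P\<close> of instances from a class \<open>C\<close> that are presented to the algorithm
  through a coding \<open>code\<close>. The algorithm halts with the right answer on every instance in \<open>C\<close>;
  membership in \<open>C\<close> is promised, and nothing is required on other inputs.
\<close>

definition decidable_on :: "('x \<Rightarrow> nat) \<Rightarrow> 'x set \<Rightarrow> ('x \<Rightarrow> bool) \<Rightarrow> bool" where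
  "decidable_on code C P \<longleftrightarrow>
     (\<exists>f. \<forall>x \<in> C. rec_eval f [code x] (if P x then 1 else 0))"


section \<open>FIFO machines as inputs of algorithms\<close>

text \<open>
  Up to renaming, every FIFO machine has natural numbers as control states, channels and messages.
  Such a machine is presented by the canonical indices of its finite components.
\<close>

fun dir_code :: "dir \<Rightarrow> nat" where
  "dir_code Send = 0"
| "dir_code Receive = 1"

fun transition_code :: "nat \<times> (nat, nat) action \<times> nat \<Rightarrow> nat" where
  "transition_code (q, (c, d, a), q') =
     prod_encode (q, prod_encode (c, prod_encode (dir_code d, prod_encode (a, q'))))"

definition machine_code :: "(nat, nat, nat) fifo_machine \<Rightarrow> nat" where
  "machine_code M =
     prod_encode (set_encode (control_states M),
     prod_encode (set_encode (channels M),
     prod_encode (set_encode (alphabet M),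
     prod_encode (set_encode (transition_code ` transitions M), initial_control M))))"

lemma inj_transition_code: "inj transition_code"
proof (rule injI)
  have dir: "d = d'" if "dir_code d = dir_code d'" for d d'
    using that by (cases d; cases d') auto
  fix t t' assume "transition_code t = transition_code t'"
  then show "t = t'"
    by (cases t rule: transition_code.cases; cases t' rule: transition_code.cases)
       (auto dest: dir)
qed

lemma finite_transitions:
  assumes "wf_fifo_machine M"
  shows "finite (transitions M)"
proof -
  have "d \<in> {Send, Receive}" for d by (cases d) simp_all
  then have "(UNIV :: dir set) \<subseteq> {Send, Receive}" by blast
  then have "finite (UNIV :: dir set)" by (rule finite_subset) simp
  then have "finite (control_states M \<times> (channels M \<times> (UNIV :: dir set) \<times> alphabet M) \<times> control_states M)"
    using assms unfolding wf_fifo_machine_def by (intro finite_cartesian_product) auto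
  moreover have "transitions M \<subseteq>
      control_states M \<times> (channels M \<times> UNIV \<times> alphabet M) \<times> control_states M"
    using assms unfolding wf_fifo_machine_def by blast
  ultimately show ?thesis by (rule rev_finite_subset)
qed

lemma inj_on_machine_code: "inj_on machine_code {M. wf_fifo_machine M}"
proof (rule inj_onI)
  fix M N :: "(nat, nat, nat) fifo_machine"
  assume MN: "M \<in> {M. wf_fifo_machine M}" "N \<in> {M. wf_fifo_machine M}"
    and eq: "machine_code M = machine_code N"
  have "finite (transition_code ` transitions M)" "finite (transition_code ` transitions N)"
    using MN finite_transitions by auto
  with MN eq have
    "control_states M = control_states N" "channels M = channels N" "alphabet M = alphabet N"
    "transition_code ` transitions M = transition_code ` transitions N"
    "initial_control M = initial_control N"
    by (auto simp: machine_code_def wf_fifo_machine_def set_encode_eq)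
  then show "M = N"
    using inj_transition_code by (simp add: inj_image_eq_iff)
qed

end

theory Submission
  imports Defs "HOL-Library.Infinite_Set"
begin

text \<open>
  In an infinite run of an input-bounded machine, the word sent on a channel is finite or ultimately
  periodic, since all its prefixes are prefixes of words in \<open>w1* ... wn*\<close>. From some time on, every
  channel that is still read therefore holds a factor of a periodic word, determined by its phase and
  its length. By the pigeonhole principle on control states and phases and by Dickson's lemma on
  lengths, some configuration recurs later with the same control state and phases and with lengths
  that are at least as large. The run segment in between can then be iterated forever, and whether a
  segment is of this kind is a decidable condition. So non-termination has finite certificates, and
  so does unboundedness: apply the same argument to a repetition-free infinite run, where the second
  configuration must be strictly longer. By Koenig's lemma, termination and boundedness are certified
  by a finite set of (timed) configurations that contains the initial one and is closed under steps.
  The algorithm searches for a certificate of either kind. It never needs the bounded languages.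
\<close>

section \<open>Computable functions of an environment\<close>

text \<open>The loop condition is local to each channel. Let a segment read x and send y on a
  channel with content w, so that w y = x w'. Then w y is a window of the word sent, and another
  round moves its left end by |x| and its right end by |y|. If both shifts are multiples of a period
  p of w y, the next round finds the same letters to read, and |x| \<le> |y| keeps the content from
  shrinking. A channel that is not read is exempt, because an aperiodic front that is never consumed
  blocks nothing. As p divides |x| > 0, the search for p is bounded.

  Neither kind of certificate comes with a bound on its size, so both are sought in a single
  minimisation, which halts because exactly one kind exists. The two problems differ in how they
  treat repetitions: termination means finitely many configurations counted with their times,
  boundedness means finitely many without times. The parameter \<delta>, 1 or 0, switches the clock
  on or off and lets one closure argument serve both.\<close>

text \<open>Functions of an environment \<open>e\<close> that inspect only finitely many of its variables. Admitting every
  sufficiently large arity spares the closure rules all bookkeeping of arities, and a quantifier or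
  recursion prepends its bound variables to the environment.\<close>

definition computable :: "((nat \<Rightarrow> nat) \<Rightarrow> nat) \<Rightarrow> bool" where
  "computable f \<longleftrightarrow> (\<exists>N. \<forall>n\<ge>N. \<exists>r. \<forall>e. rec_eval r (map e [0..<n]) (f e))"

definition dec :: "((nat \<Rightarrow> nat) \<Rightarrow> bool) \<Rightarrow> bool" where
  "dec P \<longleftrightarrow> computable (\<lambda>e. if P e then 1 else 0)"

lemma compI: "(\<And>n. N \<le> n \<Longrightarrow> \<exists>r. \<forall>e. rec_eval r (map e [0..<n]) (f e)) \<Longrightarrow> computable f"
  unfolding computable_def by blast

lemma compE:
  assumes "computable f"
  obtains N r where "\<And>n e. N \<le> n \<Longrightarrow> rec_eval (r n) (map e [0..<n]) (f e)"
proof -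
  from assms obtain N where "\<forall>n. \<exists>r. N \<le> n \<longrightarrow> (\<forall>e. rec_eval r (map e [0..<n]) (f e))"
    unfolding computable_def by blast
  from choice[OF this] show thesis using that by blast
qed

lemma comp_aritiesE:
  assumes "computable f"
  obtains n r where "k \<le> n" "\<And>e. rec_eval r (map e [0..<n]) (f e)"
proof -
  from assms obtain N r where "\<And>n e. N \<le> n \<Longrightarrow> rec_eval (r n) (map e [0..<n]) (f e)"
    by (rule compE) blast
  then show thesis using that[of "max k N" "r (max k N)"] by simp
qed

lemma comp_var: "computable (\<lambda>e. e i)"
proof (rule compI[of "Suc i"])
  fix n assume "Suc i \<le> n"
  then have "rec_eval (Proj i) (map e [0..<n]) (e i)" for e
    using rec_eval.proj[of i "map e [0..<n]"] by simp
  then show "\<exists>r. \<forall>e. rec_eval r (map e [0..<n]) (e i)" by blast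
qed

text \<open>The family \<open>h\<close> is infinite, but \<open>F\<close> has an evaluator of some
  fixed arity \<open>k\<close>, so only \<open>h 0, ..., h (k - 1)\<close> are composed and the
  maximum of their thresholds suffices.\<close>

lemma comp_subst:
  assumes F: "computable F" and h: "\<And>i. computable (h i)"
  shows "computable (\<lambda>e. F (\<lambda>i. h i e))"
proof -
  from F obtain k rF where rF: "\<And>e. rec_eval rF (map e [0..<k]) (F e)"
    unfolding computable_def by blast
  have "\<forall>i. \<exists>N. \<forall>n\<ge>N. \<exists>r. \<forall>e. rec_eval r (map e [0..<n]) (h i e)"
    using h unfolding computable_def by blast
  from choice[OF this] obtain N where
    N: "\<forall>i. \<forall>n\<ge>N i. \<exists>r. \<forall>e. rec_eval r (map e [0..<n]) (h i e)" by blast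
  then have "\<forall>i. \<exists>r. \<forall>n. N i \<le> n \<longrightarrow> (\<forall>e. rec_eval (r n) (map e [0..<n]) (h i e))"
    by (intro allI choice) blast
  from choice[OF this] obtain r where
    r: "\<And>i n e. N i \<le> n \<Longrightarrow> rec_eval (r i n) (map e [0..<n]) (h i e)" by blast
  show ?thesis
  proof (rule compI[of "Max (N ` {..<k})"])
    fix n assume n: "Max (N ` {..<k}) \<le> n"
    have le: "N i \<le> n" if "i < k" for i
      using that n by (meson Max_ge finite_imageI finite_lessThan imageI lessThan_iff order_trans)
    have "rec_eval (Comp rF (map (\<lambda>i. r i n) [0..<k])) (map e [0..<n]) (F (\<lambda>i. h i e))" for e
      by (rule rec_eval.comp[where ys = "map (\<lambda>i. h i e) [0..<k]"])
        (auto intro: r le rF[of "\<lambda>i. h i e"])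
    then show "\<exists>r. \<forall>e. rec_eval r (map e [0..<n]) (F (\<lambda>i. h i e))" by blast
  qed
qed

lemma comp1: "computable (\<lambda>e. F (e 0)) \<Longrightarrow> computable f \<Longrightarrow> computable (\<lambda>e. F (f e))"
  using comp_subst[of "\<lambda>e. F (e 0)" "\<lambda>_. f"] by simp

text \<open>Substitution needs a value for every variable; here all variables from index 1 on
  receive \<open>g\<close>.\<close>

lemma comp2:
  assumes "computable (\<lambda>e. F (e 0) (e (Suc 0)))" "computable f" "computable g"
  shows "computable (\<lambda>e. F (f e) (g e))"
  using comp_subst[of "\<lambda>e. F (e 0) (e (Suc 0))" "case_nat f (\<lambda>_. g)"] assms
  by (simp split: nat.split)

lemma comp3:
  assumes "computable (\<lambda>e. F (e 0) (e (Suc 0)) (e (Suc (Suc 0))))" "computable f" "computable g" "computable h"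
  shows "computable (\<lambda>e. F (f e) (g e) (h e))"
  using comp_subst[of "\<lambda>e. F (e 0) (e (Suc 0)) (e (Suc (Suc 0)))"
      "case_nat f (case_nat g (\<lambda>_. h))"] assms
  by (simp split: nat.split)

lemma comp4:
  assumes "computable (\<lambda>e. F (e 0) (e (Suc 0)) (e (Suc (Suc 0))) (e (Suc (Suc (Suc 0)))))"
    "computable f" "computable g" "computable h" "computable k"
  shows "computable (\<lambda>e. F (f e) (g e) (h e) (k e))"
  using comp_subst[of "\<lambda>e. F (e 0) (e (Suc 0)) (e (Suc (Suc 0))) (e (Suc (Suc (Suc 0))))"
      "case_nat f (case_nat g (case_nat h (\<lambda>_. k)))"] assms
  by (simp split: nat.split)

lemma dec2:
  "dec (\<lambda>e. P (e 0) (e (Suc 0))) \<Longrightarrow> computable f \<Longrightarrow> computable g \<Longrightarrow> dec (\<lambda>e. P (f e) (g e))"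
  unfolding dec_def by (rule comp2[where F = "\<lambda>x y. if P x y then 1 else 0"])

lemma dec3:
  "dec (\<lambda>e. P (e 0) (e (Suc 0)) (e (Suc (Suc 0)))) \<Longrightarrow> computable f \<Longrightarrow> computable g \<Longrightarrow> computable h \<Longrightarrow>
   dec (\<lambda>e. P (f e) (g e) (h e))"
  unfolding dec_def by (rule comp3[where F = "\<lambda>x y z. if P x y z then 1 else 0"])

lemma comp_Suc: "computable f \<Longrightarrow> computable (\<lambda>e. Suc (f e))"
proof (rule comp1[where F = Suc], rule compI[of 1])
  fix n :: nat assume "1 \<le> n"
  then have "rec_eval (Comp Succ [Proj 0]) (map e [0..<n]) (Suc (e 0))" for e
    using rec_eval.proj[of 0 "map e [0..<n]"]
    by (intro rec_eval.comp[where ys = "[e 0]"]) (auto intro: rec_eval.succ)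
  then show "\<exists>r. \<forall>e. rec_eval r (map e [0..<n]) (Suc (e 0))" by blast
qed

lemma comp_const: "computable (\<lambda>_. k)"
proof (induction k)
  case 0
  show ?case by (rule compI[of 0]) (blast intro: rec_eval.zero)
qed (rule comp_Suc)

text \<open>An argument list with a new head is again the listing of an environment; this is how
  bound variables enter.\<close>

lemma map_env_Cons: "x # map e [0..<n] = map (case_nat x e) [0..<Suc n]"
  by (rule nth_equalityI) (auto simp: nth_Cons simp del: upt_Suc split: nat.split)

text \<open>The step function finds the previous value at index 0, the counter at index 1 and the
  outer environment from index 2 on, the order in which \<open>PrimRec\<close> passes its arguments.
  Hence it is evaluated at arity \<open>n + 2\<close>.\<close>

lemma comp_rec_nat:
  assumes a: "computable a" and g: "computable (\<lambda>e. g (e (Suc 0)) (e 0) (\<lambda>i. e (Suc (Suc i))))" and m: "computable m"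
  shows "computable (\<lambda>e. rec_nat (a e) (\<lambda>k y. g k y e) (m e))"
proof -
  from a obtain Na ra where ra: "\<And>n e. Na \<le> n \<Longrightarrow> rec_eval (ra n) (map e [0..<n]) (a e)"
    by (rule compE) blast
  from g obtain Ng rg where rg: "\<And>n e. Ng \<le> n \<Longrightarrow>
      rec_eval (rg n) (map e [0..<n]) (g (e (Suc 0)) (e 0) (\<lambda>i. e (Suc (Suc i))))"
    by (rule compE) blast
  from m obtain Nm rm where rm: "\<And>n e. Nm \<le> n \<Longrightarrow> rec_eval (rm n) (map e [0..<n]) (m e)"
    by (rule compE) blast
  show ?thesis
  proof (rule compI[of "Na + Ng + Nm"])
    fix n assume n: "Na + Ng + Nm \<le> n"
    have rec: "rec_eval (PrimRec (ra n) (rg (n + 2))) (k # map e [0..<n])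
        (rec_nat (a e) (\<lambda>k y. g k y e) k)" for k e
    proof (induction k)
      case 0
      show ?case using n by (auto intro!: rec_eval.primrec_0 ra)
    next
      case (Suc k)
      let ?y = "rec_nat (a e) (\<lambda>k y. g k y e) k"
      have "rec_eval (rg (n + 2)) (?y # k # map e [0..<n]) (g k ?y e)"
        using rg[of "n + 2" "case_nat ?y (case_nat k e)"] n unfolding map_env_Cons by simp
      with Suc show ?case by (auto intro: rec_eval.primrec_Suc)
    qed
    have "rec_eval (Comp (PrimRec (ra n) (rg (n + 2))) (rm n # map Proj [0..<n])) (map e [0..<n])
        (rec_nat (a e) (\<lambda>k y. g k y e) (m e))" for e
    proof (rule rec_eval.comp[where ys = "m e # map e [0..<n]"])
      show "\<forall>i < length (rm n # map Proj [0..<n]).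
          rec_eval ((rm n # map Proj [0..<n]) ! i) (map e [0..<n]) ((m e # map e [0..<n]) ! i)"
        using rm[of n e] n rec_eval.proj[of _ "map e [0..<n]"]
        by (auto simp: nth_Cons split: nat.split)
      show "rec_eval (PrimRec (ra n) (rg (n + 2))) (m e # map e [0..<n])
          (rec_nat (a e) (\<lambda>k y. g k y e) (m e))"
        by (rule rec)
    qed simp
    then show "\<exists>r. \<forall>e. rec_eval r (map e [0..<n]) (rec_nat (a e) (\<lambda>k y. g k y e) (m e))"
      by blast
  qed
qed

lemma comp_shift2: "computable f \<Longrightarrow> computable (\<lambda>e. f (\<lambda>i. e (Suc (Suc i))))"
  by (erule comp_subst) (rule comp_var)

text \<open>A primitive recursion whose number of rounds is the truth value 0 or 1.\<close>

lemma comp_if: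
  assumes "dec P" "computable f" "computable g"
  shows "computable (\<lambda>e. if P e then f e else g e)"
proof -
  have "computable (\<lambda>e. rec_nat (g e) (\<lambda>_ _. f e) (if P e then 1 else 0))"
    using assms unfolding dec_def by (intro comp_rec_nat comp_shift2)
  moreover have "rec_nat y (\<lambda>_ _. x) (if b then 1 else 0) = (if b then x else y)" for x y :: nat and b
    by simp
  ultimately show ?thesis by (simp only:)
qed

section \<open>Arithmetic and Boolean connectives\<close>

lemma comp_diff: "computable f \<Longrightarrow> computable g \<Longrightarrow> computable (\<lambda>e. f e - g e)"
proof (rule comp2[where F = minus])
  \<comment> \<open>The predecessor is the recursion that ignores the previous value and returns the
    counter; subtraction iterates it.\<close>
  have "computable (\<lambda>e. rec_nat 0 (\<lambda>k _. k) (e 0))"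
    by (intro comp_rec_nat comp_const comp_var)
  moreover have "rec_nat 0 (\<lambda>k _. k) n = n - 1" for n
    by (cases n) auto
  ultimately have pred: "computable (\<lambda>e. e 0 - 1)" by simp
  have "computable (\<lambda>e. rec_nat (e 0) (\<lambda>_ y. y - 1) (e (Suc 0)))"
    by (intro comp_rec_nat comp_const comp_var comp1[OF pred])
  moreover have "rec_nat m (\<lambda>_ y. y - 1) n = m - n" for m n :: nat
    by (induction n) auto
  ultimately show "computable (\<lambda>e. e 0 - e (Suc 0))" by simp
qed

lemma comp_add: "computable f \<Longrightarrow> computable g \<Longrightarrow> computable (\<lambda>e. f e + g e)"
proof (rule comp2[where F = plus])
  have "computable (\<lambda>e. rec_nat (e 0) (\<lambda>_ y. Suc y) (e (Suc 0)))"
    by (intro comp_rec_nat comp_var comp_Suc)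
  moreover have "rec_nat m (\<lambda>_ y. Suc y) n = m + n" for m n :: nat
    by (induction n) auto
  ultimately show "computable (\<lambda>e. e 0 + e (Suc 0))" by simp
qed

lemma comp_mult: "computable f \<Longrightarrow> computable g \<Longrightarrow> computable (\<lambda>e. f e * g e)"
proof (rule comp2[where F = times])
  have "computable (\<lambda>e. rec_nat 0 (\<lambda>_ y. e 0 + y) (e (Suc 0)))"
    by (intro comp_rec_nat comp_const comp_var comp_add)
  moreover have "rec_nat 0 (\<lambda>_ y. m + y) n = m * n" for m n :: nat
    by (induction n) auto
  ultimately show "computable (\<lambda>e. e 0 * e (Suc 0))" by simp
qed

lemma comp_power: "computable f \<Longrightarrow> computable g \<Longrightarrow> computable (\<lambda>e. f e ^ g e)"
proof (rule comp2[where F = power])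
  have "computable (\<lambda>e. rec_nat 1 (\<lambda>_ y. e 0 * y) (e (Suc 0)))"
    by (intro comp_rec_nat comp_const comp_var comp_mult)
  moreover have "rec_nat 1 (\<lambda>_ y. m * y) n = m ^ n" for m n :: nat
    by (induction n) auto
  ultimately show "computable (\<lambda>e. e 0 ^ e (Suc 0))" by simp
qed

lemma dec_le:
  assumes "computable f" "computable g"
  shows "dec (\<lambda>e. f e \<le> g e)"
proof -
  have "computable (\<lambda>e. 1 - (f e - g e))" by (intro comp_diff comp_const assms)
  moreover have "1 - (m - n) = (if m \<le> n then 1 else 0)" for m n :: nat by simp
  ultimately show ?thesis unfolding dec_def by (simp only:)
qed

lemma dec_not:
  assumes "dec P"
  shows "dec (\<lambda>e. \<not> P e)"
proof -
  have "computable (\<lambda>e. if P e then 0 else 1)" by (intro comp_if comp_const assms)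
  moreover have "(if b then 0 else 1) = (if \<not> b then 1 else (0::nat))" for b by simp
  ultimately show ?thesis unfolding dec_def by (simp only:)
qed

lemma dec_conj:
  assumes "dec P" "dec Q"
  shows "dec (\<lambda>e. P e \<and> Q e)"
proof -
  have "computable (\<lambda>e. if P e then if Q e then 1 else 0 else 0)" by (intro comp_if comp_const assms)
  moreover have "(if b then if c then 1 else 0 else 0) = (if b \<and> c then 1 else (0::nat))" for b c
    by simp
  ultimately show ?thesis unfolding dec_def by (simp only:)
qed

lemma dec_disj: "dec P \<Longrightarrow> dec Q \<Longrightarrow> dec (\<lambda>e. P e \<or> Q e)"
  using dec_not[of "\<lambda>e. \<not> P e \<and> \<not> Q e"] dec_conj[of "\<lambda>e. \<not> P e" "\<lambda>e. \<not> Q e"] dec_not[of P] dec_not[of Q]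
  by simp

lemma dec_imp: "dec P \<Longrightarrow> dec Q \<Longrightarrow> dec (\<lambda>e. P e \<longrightarrow> Q e)"
  unfolding imp_conv_disj by (intro dec_disj dec_not)

lemma dec_eq: "computable f \<Longrightarrow> computable g \<Longrightarrow> dec (\<lambda>e. f e = g e)"
  unfolding eq_iff by (intro dec_conj dec_le)

lemma dec_less: "computable f \<Longrightarrow> computable g \<Longrightarrow> dec (\<lambda>e. f e < g e)"
  unfolding less_eq_Suc_le by (intro dec_le comp_Suc)

section \<open>Minimisation and bounded quantifiers\<close>

lemma rec_eval_Mu_Least:
  assumes "\<And>z. rec_eval r (z # xs) (if P z then 0 else 1)" "\<exists>z. P z"
  shows "rec_eval (Mu r) xs (LEAST z. P z)"
proof (rule rec_eval.mu)
  show "rec_eval r ((LEAST z. P z) # xs) 0"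
    using assms(1)[of "LEAST z. P z"] LeastI_ex[OF assms(2)] by simp
  show "\<forall>m < (LEAST z. P z). \<exists>y. rec_eval r (m # xs) (Suc y)"
  proof (intro allI impI)
    fix m assume "m < (LEAST z. P z)"
    then have "\<not> P m" by (rule not_less_Least)
    then show "\<exists>y. rec_eval r (m # xs) (Suc y)" using assms(1)[of m] by auto
  qed
qed

text \<open>Minimisation looks for a zero, whereas \<open>dec\<close> represents truth by 1.\<close>

lemma dec_not_0: "dec P \<Longrightarrow> computable (\<lambda>e. if P e then 0 else 1)"
  by (intro comp_if comp_const)

lemma comp_Least:
  assumes P: "dec (\<lambda>e. P (e 0) (\<lambda>i. e (Suc i)))" and ex: "\<And>e. \<exists>z. P z e"
  shows "computable (\<lambda>e. LEAST z. P z e)"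
proof -
  obtain N r where r: "\<And>n e. N \<le> n \<Longrightarrow>
      rec_eval (r n) (map e [0..<n]) (if P (e 0) (\<lambda>i. e (Suc i)) then 0 else 1)"
    using compE[OF dec_not_0[OF P]] by blast
  show ?thesis
  proof (rule compI[of N])
    fix n assume "N \<le> n"
    then have "rec_eval (r (Suc n)) (z # map e [0..<n]) (if P z e then 0 else 1)" for z e
      using r[of "Suc n" "case_nat z e"] unfolding map_env_Cons by simp
    then have "rec_eval (Mu (r (Suc n))) (map e [0..<n]) (LEAST z. P z e)" for e
      using ex by (intro rec_eval_Mu_Least)
    then show "\<exists>r. \<forall>e. rec_eval r (map e [0..<n]) (LEAST z. P z e)" by blast
  qed
qed

lemma comp_shift: "computable f \<Longrightarrow> computable (\<lambda>e. f (\<lambda>i. e (Suc i)))"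
  by (erule comp_subst) (rule comp_var)

text \<open>Search for the first counterexample. The alternative \<open>n e \<le> i\<close> makes
  the search total, and it stops exactly at \<open>n e\<close> when there is no counterexample
  below.\<close>

lemma dec_all:
  assumes "computable n" "dec (\<lambda>e. P (e 0) (\<lambda>i. e (Suc i)))"
  shows "dec (\<lambda>e. \<forall>i<n e. P i e)"
proof -
  have "dec (\<lambda>e. (LEAST i. \<not> P i e \<or> n e \<le> i) = n e)"
    by (intro dec_eq comp_Least dec_disj dec_not dec_le comp_var comp_shift assms) blast
  moreover have "(LEAST i. \<not> P i e \<or> n e \<le> i) = n e \<longleftrightarrow> (\<forall>i<n e. P i e)" for e
  proof
    assume "(LEAST i. \<not> P i e \<or> n e \<le> i) = n e"
    then show "\<forall>i<n e. P i e" using not_less_Least[of _ "\<lambda>i. \<not> P i e \<or> n e \<le> i"] by auto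
  next
    assume "\<forall>i<n e. P i e"
    then show "(LEAST i. \<not> P i e \<or> n e \<le> i) = n e"
      by (intro Least_equality) (auto simp: not_less[symmetric])
  qed
  ultimately show ?thesis by simp
qed

lemma dec_ex:
  assumes "computable n" "dec (\<lambda>e. P (e 0) (\<lambda>i. e (Suc i)))"
  shows "dec (\<lambda>e. \<exists>i<n e. P i e)"
  using dec_not[of "\<lambda>e. \<forall>i<n e. \<not> P i e"] dec_all[of n "\<lambda>i e. \<not> P i e"] dec_not[OF assms(2)] assms(1)
  by simp

lemmas comp_rules = comp_const comp_var comp_Suc comp_add comp_mult comp_diff comp_power comp_if
  dec_not dec_conj dec_disj dec_imp dec_eq dec_le dec_less dec_all dec_ex

text \<open>The two halves of the promise problem need only be semidecidable on the promised instances; on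
  other inputs the search may diverge.\<close>

lemma decidable_onI:
  assumes A: "dec (\<lambda>e. A (e (Suc 0)) (e 0))" and B: "dec (\<lambda>e. B (e (Suc 0)) (e 0))"
    and yes: "\<And>x. x \<in> C \<Longrightarrow> P x \<longleftrightarrow> (\<exists>z. A (code x) z)"
    and no: "\<And>x. x \<in> C \<Longrightarrow> \<not> P x \<longleftrightarrow> (\<exists>z. B (code x) z)"
  shows "decidable_on code C P"
proof -
  define D where "D m z \<longleftrightarrow> A m z \<or> B m z" for m z
  have "dec (\<lambda>e. D (e (Suc 0)) (e 0))"
    unfolding D_def by (intro dec_disj A B)
  from dec_not_0[OF this] obtain n r where n: "2 \<le> n"
    and r: "\<And>e. rec_eval r (map e [0..<n]) (if D (e (Suc 0)) (e 0) then 0 else 1)"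
    by (rule comp_aritiesE[of _ 2]) blast
  obtain n' s where n': "2 \<le> n'"
    and s: "\<And>e. rec_eval s (map e [0..<n']) (if A (e (Suc 0)) (e 0) then 1 else 0)"
    by (rule comp_aritiesE[OF A[unfolded dec_def], of 2]) blast
  \<comment> \<open>The evaluators exist at some arity that is at least 2, while the search has just
    the candidate \<open>z\<close> and the input \<open>m\<close>; the remaining variables are
    filled with zeros.\<close>
  let ?pad = "\<lambda>k. Proj 0 # Proj 1 # replicate (k - 2) Zero"
  have pad: "rec_eval (Comp f (?pad k)) [z, m] y"
    if "2 \<le> k" "rec_eval f (map (case_nat z (case_nat m (\<lambda>_. 0))) [0..<k]) y" for f k z m y
  proof (rule rec_eval.comp[where ys = "z # m # replicate (k - 2) 0"])
    have *: "rec_eval (Proj 0) [z, m] z" "rec_eval (Proj 1) [z, m] m"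
      using rec_eval.proj[of 0 "[z, m]"] rec_eval.proj[of 1 "[z, m]"] by simp_all
    show "\<forall>i < length (?pad k). rec_eval (?pad k ! i) [z, m] ((z # m # replicate (k - 2) 0) ! i)"
      using * rec_eval.zero by (auto simp: nth_Cons split: nat.split)
    have "map (case_nat z (case_nat m (\<lambda>_. 0))) [0..<k] = z # m # replicate (k - 2) 0"
      using that(1) by (intro nth_equalityI) (auto simp: nth_Cons split: nat.split)
    with that(2) show "rec_eval f (z # m # replicate (k - 2) 0) y" by simp
  qed simp
  \<comment> \<open>Find the least witness of either kind, then test whether it is one for
    \<open>A\<close>.\<close>
  let ?f = "Comp (Comp s (?pad n')) [Mu (Comp r (?pad n)), Proj 0]"
  have "rec_eval ?f [code x] (if P x then 1 else 0)" if x: "x \<in> C" for x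
  proof -
    let ?z = "LEAST z. D (code x) z"
    have ex: "\<exists>z. D (code x) z" using yes[OF x] no[OF x] unfolding D_def by blast
    \<comment> \<open>On a promised instance \<open>A\<close> and \<open>B\<close> cannot both have
      witnesses, so the kind of the least witness is the answer.\<close>
    have "A (code x) ?z \<longleftrightarrow> P x"
      using LeastI_ex[OF ex] yes[OF x] no[OF x] unfolding D_def by blast
    then have "rec_eval (Comp s (?pad n')) [?z, code x] (if P x then 1 else 0)"
      using s[of "case_nat ?z (case_nat (code x) (\<lambda>_. 0))"] by (intro pad[OF n']) simp
    moreover have "rec_eval (Comp r (?pad n)) [z, code x] (if D (code x) z then 0 else 1)" for z
      using r[of "case_nat z (case_nat (code x) (\<lambda>_. 0))"] by (intro pad[OF n]) simp
    then have "rec_eval (Mu (Comp r (?pad n))) [code x] ?z"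
      by (rule rec_eval_Mu_Least) (rule ex)
    moreover have "rec_eval (Proj 0) [code x] (code x)"
      using rec_eval.proj[of 0 "[code x]"] by simp
    ultimately show ?thesis
      by (intro rec_eval.comp[where ys = "[?z, code x]" and gs = "[_, _]"])
        (simp_all add: less_Suc_eq all_conj_distrib)
  qed
  then show ?thesis unfolding decidable_on_def by blast
qed

section \<open>Codes of pairs, sets and lists\<close>

definition pfst :: "nat \<Rightarrow> nat" where "pfst z = fst (prod_decode z)"
definition psnd :: "nat \<Rightarrow> nat" where "psnd z = snd (prod_decode z)"

lemma pfst_prod_encode [simp]: "pfst (prod_encode (a, b)) = a"
  and psnd_prod_encode [simp]: "psnd (prod_encode (a, b)) = b"
  by (simp_all add: pfst_def psnd_def)

lemma prod_encode_eq_iff: "prod_encode (a, b) = z \<longleftrightarrow> pfst z = a \<and> psnd z = b"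
  by (metis pfst_def prod.collapse prod_decode_inverse prod_encode_inverse psnd_def fst_conv snd_conv)

lemma psnd_le: "psnd z \<le> z"
  using le_prod_encode_2[of "psnd z" "pfst z"] by (simp add: pfst_def psnd_def)

lemma comp_prod_encode:
  "computable f \<Longrightarrow> computable g \<Longrightarrow> computable (\<lambda>e. prod_encode (f e, g e))"
proof (rule comp2[where F = "\<lambda>a b. prod_encode (a, b)"])
  have "computable (\<lambda>e. rec_nat 0 (\<lambda>k y. y + Suc k) (e 0))"
    by (intro comp_rec_nat comp_rules)
  moreover have "rec_nat 0 (\<lambda>k y. y + Suc k) n = triangle n" for n
    by (induction n) auto
  ultimately have "computable (\<lambda>e. triangle (e 0))" by simp
  from comp1[OF this] show "computable (\<lambda>e. prod_encode (e 0, e (Suc 0)))"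
    unfolding prod_encode_def by (simp add: comp_rules)
qed

text \<open>The second component is at most the pair code by \<open>psnd_le\<close>, which turns the
  inner search into a bounded quantifier.\<close>

lemma comp_pfst: "computable f \<Longrightarrow> computable (\<lambda>e. pfst (f e))"
proof (rule comp1[where F = pfst])
  have "computable (\<lambda>e. LEAST a. \<exists>b < Suc (e 0). prod_encode (a, b) = e 0)"
    by (intro comp_Least comp_rules comp_prod_encode)
      (metis le_imp_less_Suc prod_encode_eq_iff psnd_le)
  moreover have "(LEAST a. \<exists>b < Suc z. prod_encode (a, b) = z) = pfst z" for z
    using psnd_le[of z] by (intro Least_equality) (auto simp: prod_encode_eq_iff)
  ultimately show "computable (\<lambda>e. pfst (e 0))" by simp
qed

lemma comp_psnd: "computable f \<Longrightarrow> computable (\<lambda>e. psnd (f e))"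
proof (rule comp1[where F = psnd])
  have "computable (\<lambda>e. LEAST b. prod_encode (pfst (e 0), b) = e 0)"
    by (intro comp_Least comp_rules comp_prod_encode comp_pfst) (metis prod_encode_eq_iff)
  moreover have "(LEAST b. prod_encode (pfst z, b) = z) = psnd z" for z
    by (intro Least_equality) (auto simp: prod_encode_eq_iff)
  ultimately show "computable (\<lambda>e. psnd (e 0))" by simp
qed

text \<open>Bit \<open>x\<close> of \<open>m\<close> in terms of sums, products and powers alone:
  \<open>h\<close> is the part of the binary expansion above the bit and \<open>l\<close> the part
  below it.\<close>

lemma set_decode_iff: "x \<in> set_decode m \<longleftrightarrow> (\<exists>h < Suc m. \<exists>l < 2 ^ x. m = (2 * h + 1) * 2 ^ x + l)"
proof
  assume "x \<in> set_decode m"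
  then have odd: "odd (m div 2 ^ x)" by (simp add: set_decode_def)
  let ?h = "m div 2 ^ x div 2"
  have "m = (2 * ?h + 1) * 2 ^ x + m mod 2 ^ x"
    using odd by (metis div_mult_mod_eq odd_two_times_div_two_succ)
  moreover have "?h < Suc m" by (meson div_le_dividend le_imp_less_Suc le_trans)
  ultimately show "\<exists>h < Suc m. \<exists>l < 2 ^ x. m = (2 * h + 1) * 2 ^ x + l"
    by (metis mod_less_divisor zero_less_numeral zero_less_power)
next
  assume "\<exists>h < Suc m. \<exists>l < 2 ^ x. m = (2 * h + 1) * 2 ^ x + l"
  then obtain h l where "l < 2 ^ x" "m = (2 * h + 1) * 2 ^ x + l" by blast
  then have "m div 2 ^ x = 2 * h + 1"
    using div_mult_self3[of "2 ^ x" "2 * h + 1" l] by simp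
  then show "x \<in> set_decode m" by (simp add: set_decode_def)
qed

lemma set_decode_less: "x \<in> set_decode m \<Longrightarrow> x < m"
proof -
  assume "x \<in> set_decode m"
  then obtain h l where "m = (2 * h + 1) * 2 ^ x + l" unfolding set_decode_iff by blast
  then have "2 ^ x \<le> m" by (simp add: add_mult_distrib)
  then show "x < m" using less_exp[of x] by linarith
qed

lemma dec_mem: "computable f \<Longrightarrow> computable g \<Longrightarrow> dec (\<lambda>e. f e \<in> set_decode (g e))"
  by (rule dec2[where P = "\<lambda>x m. x \<in> set_decode m"]) (unfold set_decode_iff, intro comp_rules)

text \<open>A nonempty list is coded by the successor of a pair, hence the decrement. On 0, the code
  of the empty list, truncation yields the pair (0, 0), so \<open>tlc\<close> fixes 0 and
  \<open>dropc\<close> may overshoot.\<close>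

definition hdc :: "nat \<Rightarrow> nat" where "hdc z = pfst (z - 1)"
definition tlc :: "nat \<Rightarrow> nat" where "tlc z = psnd (z - 1)"
definition dropc :: "nat \<Rightarrow> nat \<Rightarrow> nat" where "dropc n z = rec_nat z (\<lambda>_. tlc) n"
definition nthc :: "nat \<Rightarrow> nat \<Rightarrow> nat" where "nthc z i = hdc (dropc i z)"
definition lenc :: "nat \<Rightarrow> nat" where "lenc z = (LEAST n. dropc n z = 0)"
definition tab :: "(nat \<Rightarrow> nat) \<Rightarrow> nat \<Rightarrow> nat" where "tab f n = list_encode (map f [0..<n])"
definition foldc :: "(nat \<Rightarrow> nat \<Rightarrow> nat) \<Rightarrow> nat \<Rightarrow> nat \<Rightarrow> nat" where
  "foldc F a z = rec_nat a (\<lambda>i y. F y (nthc z i)) (lenc z)"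

lemma hdc_Cons [simp]: "hdc (list_encode (x # xs)) = x"
  by (simp add: hdc_def)

lemma tlc_list_encode [simp]: "tlc (list_encode xs) = list_encode (tl xs)"
proof (cases xs)
  case Nil
  then show ?thesis using psnd_prod_encode[of 0 0] by (simp add: tlc_def prod_encode_def)
qed (simp add: tlc_def)

lemma list_encode_eq_0 [simp]: "list_encode xs = 0 \<longleftrightarrow> xs = []"
  by (cases xs) auto

lemma dropc_list_encode [simp]: "dropc n (list_encode xs) = list_encode (drop n xs)"
  by (induction n) (auto simp: dropc_def drop_Suc tl_drop)

lemma nthc_list_encode [simp]: "i < length xs \<Longrightarrow> nthc (list_encode xs) i = xs ! i"
  by (simp add: nthc_def Cons_nth_drop_Suc[symmetric] del: list_encode.simps)

lemma lenc_list_encode [simp]: "lenc (list_encode xs) = length xs"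
  unfolding lenc_def by (intro Least_equality) auto

lemma foldc_list_encode: "foldc F a (list_encode xs) = foldl F a xs"
proof -
  have "n \<le> length xs \<Longrightarrow>
      rec_nat a (\<lambda>i y. F y (nthc (list_encode xs) i)) n = foldl F a (take n xs)" for n
    by (induction n) (auto simp: take_Suc_conv_app_nth)
  then show ?thesis by (simp add: foldc_def)
qed

lemma lenc_tab [simp]: "lenc (tab f n) = n" and nthc_tab [simp]: "i < n \<Longrightarrow> nthc (tab f n) i = f i"
  by (simp_all add: tab_def)

lemma comp_hdc: "computable f \<Longrightarrow> computable (\<lambda>e. hdc (f e))"
  unfolding hdc_def by (intro comp_pfst comp_rules)

lemma comp_tlc: "computable f \<Longrightarrow> computable (\<lambda>e. tlc (f e))"
  unfolding tlc_def by (intro comp_psnd comp_rules)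

lemma comp_dropc: "computable f \<Longrightarrow> computable g \<Longrightarrow> computable (\<lambda>e. dropc (f e) (g e))"
  unfolding dropc_def by (rule comp_rec_nat) (assumption | intro comp_tlc comp_var)+

lemma comp_nthc: "computable f \<Longrightarrow> computable g \<Longrightarrow> computable (\<lambda>e. nthc (f e) (g e))"
  unfolding nthc_def by (intro comp_hdc comp_dropc)

lemma comp_lenc: "computable f \<Longrightarrow> computable (\<lambda>e. lenc (f e))"
proof (rule comp1[where F = lenc])
  \<comment> \<open>Every number codes a list, so the search for the length succeeds on all
    inputs.\<close>
  have "dropc (lenc z) z = 0" for z
    by (metis dropc_list_encode drop_all lenc_list_encode list_decode_inverse list_encode.simps(1)
        order_refl)
  then show "computable (\<lambda>e. lenc (e 0))"
    unfolding lenc_def by (intro comp_Least comp_dropc comp_rules) blast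
qed

text \<open>List codes grow at the head. Stage \<open>j\<close> of the recursion therefore prepends
  the entry with index \<open>n e - Suc j\<close>, and after \<open>k\<close> stages the last
  \<open>k\<close> entries are in place.\<close>

lemma comp_tab:
  assumes n: "computable n" and f: "computable (\<lambda>e. f (e 0) (\<lambda>i. e (Suc i)))"
  shows "computable (\<lambda>e. tab (\<lambda>i. f i e) (n e))"
proof -
  have "computable (\<lambda>e. f (n (\<lambda>i. e (Suc (Suc i))) - Suc (e (Suc 0))) (\<lambda>i. e (Suc (Suc i))))"
    using comp_subst[OF f, of "case_nat (\<lambda>e. n (\<lambda>i. e (Suc (Suc i))) - Suc (e (Suc 0)))
        (\<lambda>i e. e (Suc (Suc i)))"]
    by (simp add: comp_rules comp_shift2[OF n] split: nat.split)
  then have "computable (\<lambda>e. rec_nat 0 (\<lambda>j y. Suc (prod_encode (f (n e - Suc j) e, y))) (n e))"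
    by (intro comp_rec_nat comp_Suc comp_prod_encode comp_rules n)
  moreover have "rec_nat 0 (\<lambda>j y. Suc (prod_encode (f (n e - Suc j) e, y))) k =
      list_encode (map (\<lambda>i. f i e) [n e - k..<n e])" if "k \<le> n e" for k e
    using that
  proof (induction k)
    case (Suc k)
    then have "[n e - Suc k..<n e] = (n e - Suc k) # [n e - k..<n e]"
      by (simp add: upt_conv_Cons Suc_diff_Suc)
    with Suc show ?case by simp
  qed simp
  from this[OF order_refl] have "rec_nat 0 (\<lambda>j y. Suc (prod_encode (f (n e - Suc j) e, y))) (n e) =
      tab (\<lambda>i. f i e) (n e)" for e
    by (simp add: tab_def)
  ultimately show ?thesis by simp
qed

lemma comp_foldc:
  assumes "computable (\<lambda>e. F (e 0) (e (Suc 0)))" "computable f" "computable g"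
  shows "computable (\<lambda>e. foldc F (f e) (g e))"
  using assms(2,3) unfolding foldc_def
  by (rule_tac comp2[where F = "\<lambda>a z. rec_nat a (\<lambda>i y. F y (nthc z i)) (lenc z)"])
    (intro comp_rec_nat comp_rules comp2[OF assms(1)] comp_nthc comp_lenc)

lemmas code_rules = comp_rules comp_prod_encode comp_pfst comp_psnd comp_hdc comp_tlc comp_nthc
  comp_lenc comp_tab dec_mem


section \<open>Certificates\<close>

definition trans_of :: "nat \<Rightarrow> nat" where "trans_of m = pfst (psnd (psnd (psnd m)))"
definition start_of :: "nat \<Rightarrow> nat" where "start_of m = psnd (psnd (psnd (psnd m)))"

definition src :: "nat \<Rightarrow> nat" where "src t = pfst t"
definition chan :: "nat \<Rightarrow> nat" where "chan t = pfst (psnd t)"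
definition dirn :: "nat \<Rightarrow> nat" where "dirn t = pfst (psnd (psnd t))"
definition msg :: "nat \<Rightarrow> nat" where "msg t = pfst (psnd (psnd (psnd t)))"
definition tgt :: "nat \<Rightarrow> nat" where "tgt t = psnd (psnd (psnd (psnd t)))"

text \<open>A configuration is coded by the list of its control state followed by the codes of the contents
  of the channels below the code of the transition set, which exceeds every channel in use.\<close>

definition initc :: "nat \<Rightarrow> nat" where
  "initc m = tab (\<lambda>i. if i = 0 then start_of m else 0) (Suc (trans_of m))"

definition snocc :: "nat \<Rightarrow> nat \<Rightarrow> nat" where
  "snocc w a = tab (\<lambda>i. if i < lenc w then nthc w i else a) (Suc (lenc w))"

definition updc :: "nat \<Rightarrow> nat \<Rightarrow> nat \<Rightarrow> nat \<Rightarrow> nat" where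
  "updc s q c v = tab (\<lambda>i. if i = 0 then q else if i = Suc c then v else nthc s i) (lenc s)"

definition sendc :: "nat \<Rightarrow> nat \<Rightarrow> nat" where
  "sendc s t = updc s (tgt t) (chan t) (snocc (nthc s (Suc (chan t))) (msg t))"

text \<open>Partial results are shifted by one: \<open>0\<close> stands for a disabled transition.\<close>

definition stepc :: "nat \<Rightarrow> nat \<Rightarrow> nat" where
  "stepc s t =
     (if nthc s 0 = src t then
        if dirn t = 0 then Suc (sendc s t)
        else if nthc s (Suc (chan t)) \<noteq> 0 \<and> hdc (nthc s (Suc (chan t))) = msg t
        then Suc (updc s (tgt t) (chan t) (tlc (nthc s (Suc (chan t))))) else 0
      else 0)"

definition runc :: "nat \<Rightarrow> nat \<Rightarrow> nat" where
  "runc s z = foldc (\<lambda>s t. if s = 0 then 0 else stepc (s - 1) t) (Suc s) z"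

text \<open>Performing only the sends of a run yields the contents \<open>w y\<close>, where \<open>w\<close> is the initial content
  and \<open>y\<close> is what the run sends.\<close>

definition sendsc :: "nat \<Rightarrow> nat \<Rightarrow> nat" where
  "sendsc s z = foldc (\<lambda>s t. if dirn t = 0 then sendc s t else s) s z"

definition periodicc :: "nat \<Rightarrow> nat \<Rightarrow> bool" where
  "periodicc p u \<longleftrightarrow> (\<forall>k<lenc u. k + p < lenc u \<longrightarrow> nthc u k = nthc u (k + p))"

definition dvdc :: "nat \<Rightarrow> nat \<Rightarrow> bool" where
  "dvdc p n \<longleftrightarrow> (\<exists>k<Suc n. n = p * k)"

text \<open>Here \<open>u\<close> codes w y = x w', where the segment reads x and sends y. Neither
  word is extracted: |y| is \<open>lenc u - lenc w\<close> and |x| is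
  \<open>lenc u - lenc w'\<close>, so the first disjunct says that x is empty and
  \<open>lenc w \<le> lenc w'\<close> says |x| \<le> |y|.\<close>

definition chanc :: "nat \<Rightarrow> nat \<Rightarrow> nat \<Rightarrow> bool" where
  "chanc w w' u \<longleftrightarrow> lenc u = lenc w' \<or> lenc w \<le> lenc w' \<and>
     (\<exists>p<Suc (lenc u). 0 < p \<and> dvdc p (lenc u - lenc w) \<and> dvdc p (lenc u - lenc w') \<and> periodicc p u)"

definition validc :: "nat \<Rightarrow> nat \<Rightarrow> bool" where
  "validc m z \<longleftrightarrow> (\<forall>i<lenc z. nthc z i \<in> set_decode (trans_of m))"

definition loopc :: "nat \<Rightarrow> nat \<Rightarrow> nat \<Rightarrow> nat \<Rightarrow> bool" where
  "loopc m s s' z \<longleftrightarrow> nthc s 0 = nthc s' 0 \<and>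
     (\<forall>c<trans_of m. chanc (nthc s (Suc c)) (nthc s' (Suc c)) (nthc (sendsc s z) (Suc c)))"

text \<open>\<open>z\<close> pairs the code of a run into the loop with the code of the loop, which
  is nonempty since 0 codes the empty list. With \<open>b = 0\<close> this certifies
  non-termination; otherwise the loop must also change the configuration, which certifies
  unboundedness. The decrements undo the shift of partial results.\<close>

definition loop_cert :: "nat \<Rightarrow> nat \<Rightarrow> nat \<Rightarrow> bool" where
  "loop_cert b m z \<longleftrightarrow> validc m (pfst z) \<and> validc m (psnd z) \<and> psnd z \<noteq> 0 \<and>
     runc (initc m) (pfst z) \<noteq> 0 \<and> runc (runc (initc m) (pfst z) - 1) (psnd z) \<noteq> 0 \<and>
     (b = 0 \<or> runc (initc m) (pfst z) \<noteq> runc (runc (initc m) (pfst z) - 1) (psnd z)) \<and>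
     loopc m (runc (initc m) (pfst z) - 1) (runc (runc (initc m) (pfst z) - 1) (psnd z) - 1) (psnd z)"

text \<open>\<open>C\<close> lists pairs of a rank and a configuration, and each step raises the
  rank by \<delta>. The bound on \<open>t\<close> loses no transition, because the code of a set
  exceeds its members, and it keeps the quantifier decidable.\<close>

definition closure_cert :: "nat \<Rightarrow> nat \<Rightarrow> nat \<Rightarrow> bool" where
  "closure_cert \<delta> m C \<longleftrightarrow> (\<exists>k<lenc C. nthc C k = prod_encode (0, initc m)) \<and>
     (\<forall>k<lenc C. \<forall>t<trans_of m. t \<in> set_decode (trans_of m) \<longrightarrow> stepc (psnd (nthc C k)) t = 0 \<or>
        (\<exists>j<lenc C. nthc C j =
           prod_encode (pfst (nthc C k) + \<delta>, stepc (psnd (nthc C k)) t - 1)))"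

section \<open>Decidability of the certificate conditions\<close>

lemma comp_trans_of: "computable f \<Longrightarrow> computable (\<lambda>e. trans_of (f e))"
  unfolding trans_of_def by (intro code_rules)

lemma comp_initc: "computable f \<Longrightarrow> computable (\<lambda>e. initc (f e))"
  by (rule comp1[where F = initc]) (unfold initc_def trans_of_def start_of_def, intro code_rules)

lemma comp_updc:
  "computable f \<Longrightarrow> computable g \<Longrightarrow> computable h \<Longrightarrow> computable k \<Longrightarrow>
   computable (\<lambda>e. updc (f e) (g e) (h e) (k e))"
  by (rule comp4[where F = updc]) (unfold updc_def, intro code_rules)

lemma comp_snocc: "computable f \<Longrightarrow> computable g \<Longrightarrow> computable (\<lambda>e. snocc (f e) (g e))"
  by (rule comp2[where F = snocc]) (unfold snocc_def, intro code_rules)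

lemma comp_sendc: "computable f \<Longrightarrow> computable g \<Longrightarrow> computable (\<lambda>e. sendc (f e) (g e))"
  by (rule comp2[where F = sendc])
    (unfold sendc_def tgt_def chan_def msg_def, intro code_rules comp_updc comp_snocc)

lemma comp_stepc: "computable f \<Longrightarrow> computable g \<Longrightarrow> computable (\<lambda>e. stepc (f e) (g e))"
  by (rule comp2[where F = stepc])
    (unfold stepc_def src_def dirn_def tgt_def chan_def msg_def,
      intro code_rules comp_updc comp_sendc)

lemma comp_runc: "computable f \<Longrightarrow> computable g \<Longrightarrow> computable (\<lambda>e. runc (f e) (g e))"
  unfolding runc_def by (intro comp_foldc comp_stepc code_rules)

lemma comp_sendsc: "computable f \<Longrightarrow> computable g \<Longrightarrow> computable (\<lambda>e. sendsc (f e) (g e))"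
  unfolding sendsc_def dirn_def by (intro comp_foldc comp_sendc code_rules)

lemma dec_periodicc: "computable f \<Longrightarrow> computable g \<Longrightarrow> dec (\<lambda>e. periodicc (f e) (g e))"
  by (rule dec2[where P = periodicc]) (unfold periodicc_def, intro code_rules)

lemma dec_dvdc: "computable f \<Longrightarrow> computable g \<Longrightarrow> dec (\<lambda>e. dvdc (f e) (g e))"
  by (rule dec2[where P = dvdc]) (unfold dvdc_def, intro code_rules)

lemma dec_chanc:
  "computable f \<Longrightarrow> computable g \<Longrightarrow> computable h \<Longrightarrow> dec (\<lambda>e. chanc (f e) (g e) (h e))"
  by (rule dec3[where P = chanc]) (unfold chanc_def, intro code_rules dec_dvdc dec_periodicc)

lemma dec_validc: "computable f \<Longrightarrow> computable g \<Longrightarrow> dec (\<lambda>e. validc (f e) (g e))"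
  by (rule dec2[where P = validc]) (unfold validc_def, intro code_rules comp_trans_of)

lemma dec_loopc:
  assumes "computable f" "computable g" "computable h" "computable k"
  shows "dec (\<lambda>e. loopc (f e) (g e) (h e) (k e))"
  unfolding dec_def
  by (rule comp4[where F = "\<lambda>m s s' z. if loopc m s s' z then 1 else 0", OF _ assms])
    (unfold dec_def[symmetric] loopc_def, intro code_rules dec_chanc comp_trans_of comp_sendsc)

lemma dec_loop_cert: "dec (\<lambda>e. loop_cert b (e (Suc 0)) (e 0))"
  unfolding loop_cert_def
  by (intro code_rules dec_validc dec_loopc comp_runc comp_initc)

lemma dec_closure_cert: "dec (\<lambda>e. closure_cert \<delta> (e (Suc 0)) (e 0))"
  unfolding closure_cert_def
  by (intro code_rules comp_stepc comp_initc comp_trans_of)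

section \<open>Runs of FIFO machines\<close>

definition recv_proj :: "'c \<Rightarrow> ('c, 'a) action list \<Rightarrow> 'a list" where
  "recv_proj c \<sigma> = concat (map (\<lambda>(c', d, a). if c' = c \<and> d = Receive then [a] else []) \<sigma>)"

lemma proj_simps [simp]:
  "send_proj c [] = []" "recv_proj c [] = []"
  "send_proj c (\<sigma> @ \<tau>) = send_proj c \<sigma> @ send_proj c \<tau>"
  "recv_proj c (\<sigma> @ \<tau>) = recv_proj c \<sigma> @ recv_proj c \<tau>"
  "send_proj c ((c', Send, a) # \<sigma>) = (if c' = c then a # send_proj c \<sigma> else send_proj c \<sigma>)"
  "recv_proj c ((c', Send, a) # \<sigma>) = recv_proj c \<sigma>"
  "send_proj c ((c', Receive, a) # \<sigma>) = send_proj c \<sigma>"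
  "recv_proj c ((c', Receive, a) # \<sigma>) = (if c' = c then a # recv_proj c \<sigma> else recv_proj c \<sigma>)"
  by (simp_all add: send_proj_def recv_proj_def)

inductive_cases steps_ConsE: "steps M s (\<alpha> # \<sigma>) s'"

lemma steps_append:
  "steps M s (\<sigma> @ \<tau>) s'' \<longleftrightarrow> (\<exists>s'. steps M s \<sigma> s' \<and> steps M s' \<tau> s'')"
proof (induction \<sigma> arbitrary: s)
  case Nil
  have "steps M s [] s' \<longleftrightarrow> s = s'" for s s' by (auto intro: steps.Nil elim: steps.cases)
  then show ?case by simp
next
  case (Cons \<alpha> \<sigma>)
  have "steps M s (\<alpha> # \<sigma>) s' \<longleftrightarrow> (\<exists>r. step M s \<alpha> r \<and> steps M r \<sigma> s')" for s \<sigma> s'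
    by (blast intro: steps.Cons elim: steps_ConsE)
  with Cons show ?case by auto
qed

lemma steps_single: "steps M s [\<alpha>] s' \<longleftrightarrow> step M s \<alpha> s'"
  by (auto intro: steps.intros elim: steps.cases)

lemma steps_content:
  "steps M s \<sigma> s' \<Longrightarrow> snd s c @ send_proj c \<sigma> = recv_proj c \<sigma> @ snd s' c"
proof (induction rule: steps.induct)
  case (Cons s \<alpha> s' \<sigma> s'')
  from Cons.hyps(1) Cons.IH show ?case by cases (auto split: if_splits)
qed simp

text \<open>A run depends on the initial contents only through the requirement that each channel can serve all
  receptions.\<close>

lemma steps_transfer:
  assumes "steps M s \<sigma> s'"
    and "\<And>c \<sigma>\<^sub>1 \<sigma>\<^sub>2. \<sigma> = \<sigma>\<^sub>1 @ \<sigma>\<^sub>2 \<Longrightarrow> prefix (recv_proj c \<sigma>\<^sub>1) (v c @ send_proj c \<sigma>\<^sub>1)"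
  shows "\<exists>v'. steps M (fst s, v) \<sigma> (fst s', v')"
  using assms
proof (induction arbitrary: v rule: steps.induct)
  case (Nil s)
  show ?case by (auto intro: steps.Nil)
next
  case (Cons s \<alpha> s' \<sigma> s'')
  have pre: "prefix (recv_proj c (\<alpha> # \<sigma>\<^sub>1)) (v c @ send_proj c (\<alpha> # \<sigma>\<^sub>1))" if "\<sigma> = \<sigma>\<^sub>1 @ \<sigma>\<^sub>2" for c \<sigma>\<^sub>1 \<sigma>\<^sub>2
    using Cons.prems[of "\<alpha> # \<sigma>\<^sub>1" \<sigma>\<^sub>2 c] that by simp
  from Cons.hyps(1) show ?case
  proof cases
    case (send q c a q' w)
    have *: "prefix (recv_proj c' \<sigma>\<^sub>1) ((v(c := v c @ [a])) c' @ send_proj c' \<sigma>\<^sub>1)"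
      if "\<sigma> = \<sigma>\<^sub>1 @ \<sigma>\<^sub>2" for c' \<sigma>\<^sub>1 \<sigma>\<^sub>2
      using pre[OF that, of c'] send by (auto split: if_splits)
    have "\<exists>v'. steps M (fst s', v(c := v c @ [a])) \<sigma> (fst s'', v')"
      by (rule Cons.IH) (rule *)
    then show ?thesis using send step.send[of q c a q' M v] by (auto intro: steps.Cons)
  next
    case (receive q c a q' w u)
    \<comment> \<open>For the first action alone the condition says that the new content starts with
      \<open>a\<close>.\<close>
    from pre[of "[]" \<sigma> c] receive obtain x where x: "v c = a # x" by (auto simp: prefix_def)
    have *: "prefix (recv_proj c' \<sigma>\<^sub>1) ((v(c := x)) c' @ send_proj c' \<sigma>\<^sub>1)"
      if "\<sigma> = \<sigma>\<^sub>1 @ \<sigma>\<^sub>2" for c' \<sigma>\<^sub>1 \<sigma>\<^sub>2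
      using pre[OF that, of c'] receive x by (auto split: if_splits)
    have "\<exists>v'. steps M (fst s', v(c := x)) \<sigma> (fst s'', v')"
      by (rule Cons.IH) (rule *)
    then show ?thesis using receive step.receive[of q c a q' M v x] x by (auto intro: steps.Cons)
  qed
qed


section \<open>Iterable loops\<close>

definition periodic :: "nat \<Rightarrow> 'a list \<Rightarrow> bool" where
  "periodic p u \<longleftrightarrow> (\<forall>k. k + p < length u \<longrightarrow> u ! k = u ! (k + p))"

text \<open>A channel without reads cannot block the segment, so its content is unrestricted.
  Otherwise the period covers old content and sent word together, including their junction.\<close>

definition chan_loop :: "'a list \<Rightarrow> 'a list \<Rightarrow> 'a list \<Rightarrow> bool" where
  "chan_loop w x y \<longleftrightarrow> x = [] \<or> length x \<le> length y \<and>
     (\<exists>p>0. p dvd length x \<and> p dvd length y \<and> periodic p (w @ y))"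

definition machine_loop ::
  "('q, 'c, 'a) fifo_machine \<Rightarrow> 'q \<Rightarrow> ('c \<Rightarrow> 'a list) \<Rightarrow> ('c, 'a) action list \<Rightarrow> ('c \<Rightarrow> 'a list) \<Rightarrow> bool" where
  "machine_loop M q w \<sigma> w' \<longleftrightarrow> steps M (q, w) \<sigma> (q, w') \<and> \<sigma> \<noteq> [] \<and>
     (\<forall>c. chan_loop (w c) (recv_proj c \<sigma>) (send_proj c \<sigma>))"

lemma periodic_nth_mod:
  assumes "periodic p u" "k < length u"
  shows "u ! k = u ! (k mod p)"
  using assms(2)
proof (induction k rule: less_induct)
  case (less k)
  show ?case
  proof (cases "p \<le> k \<and> p > 0")
    case True
    then have "u ! (k - p) = u ! k" using assms(1) less.prems by (auto simp: periodic_def)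
    moreover have "u ! (k - p) = u ! ((k - p) mod p)" using True less by simp
    ultimately show ?thesis using True by (simp add: le_mod_geq)
  next
    case False
    then show ?thesis by (cases "p = 0") auto
  qed
qed

text \<open>The contents of a channel at the successive iterations: prefixes of the infinite word of period
  \<open>p\<close> that extends \<open>w y\<close>, cut at positions congruent modulo \<open>p\<close>.\<close>

definition pumped :: "'a list \<Rightarrow> 'a list \<Rightarrow> 'a list \<Rightarrow> 'a list \<Rightarrow> bool" where
  "pumped w x y v \<longleftrightarrow> x = [] \<or> length x \<le> length y \<and>
     (\<exists>p f j. p dvd length x \<and> p dvd length y \<and> (\<forall>k. f (k + p) = f k) \<and>
        w @ y = map f [0..<length (w @ y)] \<and> v = map f [0..<length w + p * j])"

lemma period_mult:
  fixes p :: nat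
  assumes "\<And>k. f (k + p) = f k"
  shows "f (k + p * j) = f k"
proof (induction j)
  case (Suc j)
  then show ?case using assms[of "k + p * j"] by (simp add: add_ac)
qed simp

lemma pumped_init:
  assumes "chan_loop w x y"
  shows "pumped w x y w"
proof (cases "x = []")
  case False
  with assms obtain p where p: "p > 0" "p dvd length x" "p dvd length y" "periodic p (w @ y)"
    and le: "length x \<le> length y"
    unfolding chan_loop_def by blast
  \<comment> \<open>The first \<open>p\<close> letters of \<open>w @ y\<close>, repeated
    forever.\<close>
  define f where "f k = (w @ y) ! (k mod p)" for k
  have wy: "w @ y = map f [0..<length (w @ y)]"
    by (rule nth_equalityI) (use periodic_nth_mod[OF p(4)] in \<open>auto simp: f_def\<close>)
  have "w = map f [0..<length w + p * 0]"
    using arg_cong[OF wy, of "take (length w)"] by (simp add: take_map)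
  moreover have "\<forall>k. f (k + p) = f k" by (simp add: f_def)
  ultimately show ?thesis unfolding pumped_def using p le wy by blast
qed (simp add: pumped_def)

text \<open>Both words are prefixes of the infinite word \<open>f\<close>: \<open>x1\<close> as a
  prefix of \<open>w @ y\<close>, and \<open>v @ y1\<close> because \<open>f\<close> does not notice
  a shift by \<open>p * j\<close>. The original execution shows that \<open>x1\<close> is no longer
  than \<open>w @ y1\<close>, hence no longer than \<open>v @ y1\<close>.\<close>

lemma pumped_prefix:
  assumes "pumped w x y v" and x: "x \<noteq> [] \<or> x1 = []" "prefix x1 x" and y: "prefix y1 y"
    and exec: "w @ y1 = x1 @ w1" "w @ y = x @ w'"
  shows "prefix x1 (v @ y1)"
proof (cases "x = []")
  case False
  with assms(1) obtain p f j where p: "p dvd length x" "p dvd length y" "\<And>k. f (k + p) = f k"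
    and wy: "w @ y = map f [0..<length (w @ y)]" and v: "v = map f [0..<length w + p * j]"
    unfolding pumped_def by blast
  have nth: "(w @ y) ! k = f k" if "k < length w + length y" for k
    using that by (subst wy) simp
  have "v @ y1 = map f [0..<length w + p * j + length y1]"
  proof (rule nth_equalityI)
    fix k assume k: "k < length (v @ y1)"
    show "(v @ y1) ! k = map f [0..<length w + p * j + length y1] ! k"
    proof (cases "k < length v")
      case False
      define i where "i = k - length v"
      have i: "k = length w + i + p * j" "i < length y1" using False k v i_def by auto
      have "f k = f (length w + i)" by (simp only: i(1) period_mult[of f, OF p(3)])
      also have "\<dots> = y ! i"
        using nth[of "length w + i"] i(2) prefix_length_le[OF y] by simp
      also have "\<dots> = y1 ! i" using y i(2) by (auto simp: prefix_def nth_append)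
      finally show ?thesis using False k v by (simp add: nth_append i_def)
    qed (use v k in \<open>simp add: nth_append\<close>)
  qed (simp add: v)
  moreover have "x1 = map f [0..<length x1]"
  proof (rule nth_equalityI)
    fix k assume k: "k < length x1"
    then have "x1 ! k = (w @ y) ! k" using x exec by (auto simp: prefix_def nth_append)
    moreover have "k < length (w @ y)" using k x exec by (auto simp: prefix_def)
    ultimately show "x1 ! k = map f [0..<length x1] ! k" using nth k by simp
  qed simp
  moreover have "length x1 \<le> length w + length y1"
    using arg_cong[OF exec(1), of length] by simp
  then obtain d where "length w + p * j + length y1 = length x1 + d"
    by (metis add.assoc add.commute le_Suc_ex)
  ultimately show ?thesis by (metis add_0 map_append prefixI upt_add_eq_append zero_le)
qed (use assms in simp)

text \<open>Consuming \<open>x\<close> shifts \<open>f\<close> by a multiple of its period, so the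
  rest is again a prefix of \<open>f\<close>. Since |x| \<le> |y|, the subtraction in the new
  exponent \<open>j + b - a\<close> is not truncated.\<close>

lemma pumped_next:
  assumes "pumped w x y v" "v @ y = x @ v'" "w @ y = x @ w'"
  shows "pumped w x y v'"
proof (cases "x = []")
  case False
  with assms(1) obtain p f j where p: "p dvd length x" "p dvd length y" "\<And>k. f (k + p) = f k"
    and wy: "w @ y = map f [0..<length (w @ y)]" and v: "v = map f [0..<length w + p * j]"
    and le: "length x \<le> length y"
    unfolding pumped_def by blast
  from p(1,2) obtain a b where ab: "length x = p * a" "length y = p * b" by (auto elim!: dvdE)
  have nth: "(w @ y) ! k = f k" if "k < length w + length y" for k
    using that by (subst wy) simp
  have len: "length v' = length w + p * (j + b - a)"
  proof -
    have "length v + length y = length x + length v'"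
      using arg_cong[OF assms(2), of length] by simp
    moreover have "p * (j + b - a) = p * j + p * b - p * a"
      by (simp add: diff_mult_distrib2 add_mult_distrib2)
    moreover have "p * a \<le> p * b" using le ab by simp
    moreover have "length v = length w + p * j" by (simp add: v)
    ultimately show ?thesis using ab by linarith
  qed
  have "v' = map f [0..<length w + p * (j + b - a)]"
  proof (rule nth_equalityI)
    fix k assume k: "k < length v'"
    have "v' ! k = (v @ y) ! (length x + k)" using assms(2) by (simp add: nth_append)
    also have "\<dots> = f (length x + k)"
    proof (cases "length x + k < length v")
      case True
      then show ?thesis using v by (simp add: nth_append)
    next
      case False
      define i where "i = length x + k - length v"
      have i: "length x + k = length w + i + p * j" "i < length y"
        using False k v i_def arg_cong[OF assms(2), of length] by auto
      have "f (length x + k) = f (length w + i)" by (simp only: i(1) period_mult[of f, OF p(3)])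
      also have "\<dots> = y ! i" using nth[of "length w + i"] i by simp
      finally show ?thesis using False by (simp add: nth_append i_def)
    qed
    also have "\<dots> = f k"
      by (simp only: ab(1) add.commute[of _ k] period_mult[of f, OF p(3)])
    finally show "v' ! k = map f [0..<length w + p * (j + b - a)] ! k" using k len by simp
  qed (simp add: len)
  then show ?thesis unfolding pumped_def using p wy le by blast
qed (simp add: pumped_def)

lemma pumped_step:
  assumes run: "steps M (q, w) \<sigma> (q, w')"
    and v: "\<And>c. pumped (w c) (recv_proj c \<sigma>) (send_proj c \<sigma>) (v c)"
  shows "\<exists>v'. steps M (q, v) \<sigma> (q, v') \<and> (\<forall>c. pumped (w c) (recv_proj c \<sigma>) (send_proj c \<sigma>) (v' c))"
proof -
  have "prefix (recv_proj c \<sigma>\<^sub>1) (v c @ send_proj c \<sigma>\<^sub>1)" if \<sigma>: "\<sigma> = \<sigma>\<^sub>1 @ \<sigma>\<^sub>2" for c \<sigma>\<^sub>1 \<sigma>\<^sub>2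
  proof -
    obtain s where "steps M (q, w) \<sigma>\<^sub>1 s" using run steps_append \<sigma> by blast
    from steps_content[OF this, of c] have "w c @ send_proj c \<sigma>\<^sub>1 = recv_proj c \<sigma>\<^sub>1 @ snd s c" by simp
    from pumped_prefix[OF v[of c] _ _ _ this, of "w' c"] show ?thesis
      using \<sigma> steps_content[OF run, of c] by auto
  qed
  note serve = this
  have "\<exists>v'. steps M (fst (q, w), v) \<sigma> (fst (q, w'), v')"
    by (rule steps_transfer[OF run]) (rule serve)
  then obtain v' where v': "steps M (q, v) \<sigma> (q, v')" by auto
  moreover have "pumped (w c) (recv_proj c \<sigma>) (send_proj c \<sigma>) (v' c)" for c
    using pumped_next[OF v] steps_content[OF v', of c] steps_content[OF run, of c] by simp
  ultimately show ?thesis by blast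
qed

text \<open>\<open>pumped\<close> says nothing about channels that are not read, so lengths are
  tracked by a separate equation, additive to avoid truncated subtraction.\<close>

lemma machine_loop_iterate:
  assumes "machine_loop M q w \<sigma> w'"
  shows "\<exists>v. steps M (q, w) (concat (replicate k \<sigma>)) (q, v) \<and>
    (\<forall>c. pumped (w c) (recv_proj c \<sigma>) (send_proj c \<sigma>) (v c)) \<and>
    (\<forall>c. length (v c) + k * length (recv_proj c \<sigma>) = length (w c) + k * length (send_proj c \<sigma>))"
proof (induction k)
  case 0
  have "pumped (w c) (recv_proj c \<sigma>) (send_proj c \<sigma>) (w c)" for c
    using assms unfolding machine_loop_def by (intro pumped_init) blast
  then show ?case by (intro exI[of _ w]) (simp add: steps.Nil)
next
  case (Suc k)
  then obtain v where v: "steps M (q, w) (concat (replicate k \<sigma>)) (q, v)"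
    "\<And>c. pumped (w c) (recv_proj c \<sigma>) (send_proj c \<sigma>) (v c)"
    "\<And>c. length (v c) + k * length (recv_proj c \<sigma>) = length (w c) + k * length (send_proj c \<sigma>)"
    by blast
  from assms have "steps M (q, w) \<sigma> (q, w')" unfolding machine_loop_def by blast
  from pumped_step[OF this v(2)] obtain v' where v': "steps M (q, v) \<sigma> (q, v')"
    "\<And>c. pumped (w c) (recv_proj c \<sigma>) (send_proj c \<sigma>) (v' c)" by blast
  have "concat (replicate (Suc k) \<sigma>) = concat (replicate k \<sigma>) @ \<sigma>"
    by (metis append_Nil2 concat.simps concat_append replicate_Suc replicate_append_same)
  then have "steps M (q, w) (concat (replicate (Suc k) \<sigma>)) (q, v')"
    using v(1) v'(1) steps_append by metis
  moreover have "length (v' c) + Suc k * length (recv_proj c \<sigma>) = length (w c) + Suc k * length (send_proj c \<sigma>)" for c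
    using v(3)[of c] arg_cong[OF steps_content[OF v'(1), of c], of length] by simp
  ultimately show ?case using v'(2) by blast
qed

text \<open>On a channel that is read, old and new content are prefixes of the same periodic word;
  if as much were read as sent, they would have equal length and coincide. On a channel that is not
  read, any change is a send.\<close>

lemma machine_loop_grows:
  assumes loop: "machine_loop M q w \<sigma> w'" and "w \<noteq> w'"
  shows "\<exists>c. length (recv_proj c \<sigma>) < length (send_proj c \<sigma>)"
proof -
  from assms(2) obtain c where c: "w c \<noteq> w' c" by blast
  have run: "steps M (q, w) \<sigma> (q, w')" and ok: "chan_loop (w c) (recv_proj c \<sigma>) (send_proj c \<sigma>)"
    using loop unfolding machine_loop_def by blast+
  note cont = steps_content[OF run, of c, simplified]
  note w = pumped_init[OF ok]
  note w' = pumped_next[OF w cont cont]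
  show ?thesis
  proof (cases "recv_proj c \<sigma> = []")
    case True
    with cont c have "send_proj c \<sigma> \<noteq> []" by auto
    with True show ?thesis by (metis length_greater_0_conv list.size(3))
  next
    case False
    have "length (recv_proj c \<sigma>) \<noteq> length (send_proj c \<sigma>)"
    proof
      assume "length (recv_proj c \<sigma>) = length (send_proj c \<sigma>)"
      then have len: "length (w' c) = length (w c)" using arg_cong[OF cont, of length] by simp
      from False w' obtain f n where f: "w c @ send_proj c \<sigma> = map f [0..<length (w c @ send_proj c \<sigma>)]"
        and n: "w' c = map f [0..<n]"
        unfolding pumped_def by blast
      have "w c = map f [0..<length (w c)]"
        using arg_cong[OF f, of "take (length (w c))"] by (simp add: take_map)
      then show False using n len c by simp
    qed
    with ok False show ?thesis unfolding chan_loop_def by (metis le_neq_implies_less)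
  qed
qed

section \<open>Infinite runs of input-bounded machines\<close>

lemma nth_concat_replicate:
  "m < k * length w \<Longrightarrow> concat (replicate k w) ! m = w ! (m mod length w)"
proof (induction k arbitrary: m)
  case (Suc k)
  then show ?case by (cases "m < length w") (auto simp: nth_append le_mod_geq)
qed simp

lemma length_concat_replicate: "length (concat (replicate k w)) = k * length w"
  by (induction k) auto

lemma prefix_map_upt: "m \<le> n \<Longrightarrow> prefix (map f [0..<m]) (map f [0..<n])"
  by (metis le_add_diff_inverse map_append prefixI upt_add_eq_append zero_le)

text \<open>Either \<open>f\<close> is \<open>w\<close> repeated forever, or it deviates from that
  at some position \<open>m\<close>. In the second case at most \<open>m\<close> copies of
  \<open>w\<close> can be used, so one number \<open>k\<close> of copies serves infinitely many
  prefixes, hence all of them. Removing these copies leaves a word for the induction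
  hypothesis.\<close>

lemma bounded_lang_ultimately_periodic:
  assumes "\<And>n. \<exists>u\<in>bounded_lang ws. prefix (map f [0..<n]) u"
  shows "\<exists>n0 p. p > 0 \<and> (\<forall>k\<ge>n0. f (k + p) = f k)"
  using assms
proof (induction ws arbitrary: f)
  case Nil
  from Nil[of 1] show ?case by simp
next
  case (Cons w ws)
  show ?case
  proof (cases "w = [] \<or> (\<exists>m. f m \<noteq> w ! (m mod length w))")
    case False
    then have "length w > 0 \<and> (\<forall>k\<ge>0. f (k + length w) = f k)" by simp
    then show ?thesis by blast
  next
    case True
    \<comment> \<open>The lengths of those prefixes of \<open>f\<close> that can be matched with
      exactly \<open>k\<close> copies of \<open>w\<close>.\<close>
    define A where "A k = {n. \<exists>v\<in>bounded_lang ws. prefix (map f [0..<n]) (concat (replicate k w) @ v)}" for k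
    have A: "\<exists>k. n \<in> A k" for n
      using Cons.prems[of n] unfolding A_def by auto
    have mono: "m \<in> A k" if "n \<in> A k" "m \<le> n" for m n k
      using that prefix_map_upt[of m n f] unfolding A_def by (blast intro: prefix_order.trans)
    have "\<exists>k. A k = UNIV"
    proof (cases "w = []")
      case True
      then have "n \<in> A 0" for n using A[of n] unfolding A_def by auto
      then show ?thesis by blast
    next
      case False
      with True obtain m where m: "f m \<noteq> w ! (m mod length w)" by blast
      have "\<exists>k\<le>m. n \<in> A k" for n
      proof -
        \<comment> \<open>The prefix has to be long enough to contain the deviation at
          \<open>m\<close>.\<close>
        obtain k where k: "max n (Suc m) \<in> A k" using A by blast
        then have "Suc m \<in> A k" using mono by simp
        then obtain v z where v: "concat (replicate k w) @ v = map f [0..<Suc m] @ z"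
          unfolding A_def by (auto simp: prefix_def)
        have "\<not> m < k * length w"
        proof
          assume "m < k * length w"
          then have "(concat (replicate k w) @ v) ! m = w ! (m mod length w)"
            by (simp add: nth_append nth_concat_replicate length_concat_replicate)
          moreover have "(map f [0..<Suc m] @ z) ! m = f m" by (simp add: nth_append del: upt_Suc)
          ultimately show False using m v by simp
        qed
        moreover have "k \<le> k * length w" using False by (cases w) auto
        ultimately show ?thesis using k mono by (meson le_trans max.cobounded1 not_le)
      qed
      then have "(\<Union>k\<le>m. A k) = UNIV" by blast
      then obtain k where inf: "infinite (A k)"
        by (metis finite_UN_I finite_atMost infinite_UNIV_nat)
      have "n \<in> A k" for n
        using inf mono[of _ k n] by (meson infinite_nat_iff_unbounded_le)
      then show ?thesis by blast
    qed
    then obtain k where k: "\<And>n. n \<in> A k" by blast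
    define d where "d = length (concat (replicate k w))"
    have "\<exists>v\<in>bounded_lang ws. prefix (map (\<lambda>i. f (d + i)) [0..<n]) v" for n
    proof -
      from k[of "d + n"] obtain v z where v: "v \<in> bounded_lang ws"
        "concat (replicate k w) @ v = map f [0..<d + n] @ z"
        unfolding A_def by (auto simp: prefix_def)
      have "drop d (map f [0..<d + n]) = map (\<lambda>i. f (d + i)) [0..<n]"
        by (rule nth_equalityI) auto
      with arg_cong[OF v(2), of "drop d"] have "v = map (\<lambda>i. f (d + i)) [0..<n] @ z"
        by (simp add: d_def)
      with v(1) show ?thesis by (intro bexI[of _ v] prefixI)
    qed
    from Cons.IH[OF this] obtain n0 p where p: "p > 0" "\<And>i. n0 \<le> i \<Longrightarrow> f (d + (i + p)) = f (d + i)"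
      by blast
    have "f (i + p) = f i" if "d + n0 \<le> i" for i
      using p(2)[of "i - d"] that by (simp add: add.assoc[symmetric])
    with p(1) show ?thesis by blast
  qed
qed

lemma prefix_chain_limit:
  assumes "\<And>i j :: nat. i \<le> j \<Longrightarrow> prefix (u i) (u j)"
  shows "\<exists>f. \<forall>i. u i = map f [0..<length (u i)]"
proof -
  \<comment> \<open>If the chain has bounded length, the letters of \<open>f\<close> beyond it are
    arbitrary.\<close>
  define f where "f k = u (SOME i. k < length (u i)) ! k" for k
  have "u i ! k = f k" if "k < length (u i)" for i k
  proof -
    define j where "j = (SOME j. k < length (u j))"
    have j: "k < length (u j)" unfolding j_def using that by (rule someI)
    have "u i ! k = u j ! k"
      using assms[of i j] assms[of j i] that j by (cases "i \<le> j") (auto simp: prefix_def nth_append)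
    then show ?thesis by (simp add: f_def j_def)
  qed
  then show ?thesis by (intro exI allI nth_equalityI) auto
qed

text \<open>From time \<open>i0\<close> on, a channel with sent words \<open>S\<close> and received words \<open>R\<close> either receives nothing or
  carries a word of period \<open>p\<close>.\<close>

definition settled :: "(nat \<Rightarrow> 'a list) \<Rightarrow> (nat \<Rightarrow> 'a list) \<Rightarrow> nat \<Rightarrow> nat \<Rightarrow> bool" where
  "settled S R i0 p \<longleftrightarrow> p > 0 \<and> ((\<forall>i\<ge>i0. R i = R i0) \<or>
     (\<exists>f. (\<forall>i. S i = map f [0..<length (S i)]) \<and> (\<forall>k\<ge>length (R i0). f (k + p) = f k)))"

lemma settled_mono:
  assumes "settled S R i0 p" "i0 \<le> i1" "\<And>i j. i \<le> j \<Longrightarrow> prefix (R i) (R j)"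
  shows "settled S R i1 p"
proof -
  have "length (R i0) \<le> length (R i1)" using assms(2,3) prefix_length_le by blast
  moreover have "\<forall>i\<ge>i1. R i = R i1" if "\<forall>i\<ge>i0. R i = R i0"
    using that assms(2) by (metis le_trans)
  ultimately show ?thesis using assms(1) unfolding settled_def by (blast intro: le_trans)
qed

text \<open>The case split is on the total length received, not sent. If it is bounded, reading
  stops once the maximum is reached. If not, the sent words are unbounded too, their limit is
  ultimately periodic, and the reads eventually pass the preperiod.\<close>

lemma settled_exists:
  assumes S: "\<And>i j. i \<le> j \<Longrightarrow> prefix (S i) (S j)" and R: "\<And>i j. i \<le> j \<Longrightarrow> prefix (R i) (R j)"
    and SR: "\<And>i. prefix (R i) (S i)"
    and bounded: "\<And>i. \<exists>u\<in>bounded_lang ws. prefix (S i) u"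
  shows "\<exists>i0 p. settled S R i0 p"
proof (cases "\<exists>B. \<forall>i. length (R i) \<le> B")
  case True
  then obtain B where "\<And>i. length (R i) \<le> B" by blast
  then obtain i0 where i0: "\<And>i. length (R i) \<le> length (R i0)"
    using ex_has_greatest_nat[of "\<lambda>_. True" 0 "\<lambda>i. length (R i)" "Suc B"]
    by (auto simp: less_Suc_eq_le)
  have "R i = R i0" if "i0 \<le> i" for i
    using R[OF that] i0[of i] by (auto simp: prefix_def)
  \<comment> \<open>The period 1 is a dummy: only its positivity matters when nothing is
    read.\<close>
  then have "settled S R i0 1" unfolding settled_def using zero_less_one by blast
  then show ?thesis by blast
next
  case False
  obtain f where f: "\<And>i. S i = map f [0..<length (S i)]" using prefix_chain_limit[of S] S by blast
  have "\<exists>u\<in>bounded_lang ws. prefix (map f [0..<n]) u" for n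
  proof -
    from False obtain i where "n \<le> length (R i)" by (meson nat_le_linear)
    then have "prefix (map f [0..<n]) (S i)"
      using SR[of i] by (subst f) (intro prefix_map_upt, auto dest: prefix_length_le)
    then show ?thesis using bounded[of i] prefix_order.trans by blast
  qed
  from bounded_lang_ultimately_periodic[OF this] obtain n0 p where
    p: "p > 0" "\<And>k. n0 \<le> k \<Longrightarrow> f (k + p) = f k" by blast
  from False obtain i0 where "n0 \<le> length (R i0)" by (meson nat_le_linear)
  then have "settled S R i0 p" unfolding settled_def using p f le_trans by blast
  then show ?thesis by blast
qed

text \<open>\<open>w @ y\<close> is the factor of the sent word between the positions |R i| and |S
  j|, and it starts beyond the preperiod. Equal phases make |x| and |y| multiples of
  \<open>p\<close>; |w| \<le> |w'| gives |x| \<le> |y|.\<close>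

lemma settled_chan_loop:
  assumes "settled S R i0 p" "i0 \<le> i" "i0 \<le> j"
    and S: "S j = S i @ y" "S i = R i @ w" and R: "R j = R i @ x" "S j = R j @ w'" "prefix (R i0) (R i)"
    and mods: "length (S i) mod p = length (S j) mod p" "length (R i) mod p = length (R j) mod p"
    and le: "length w \<le> length w'"
  shows "chan_loop w x y"
proof (cases "x = []")
  case False
  with assms(1-3) R(1) obtain f where p: "p > 0" and f: "S j = map f [0..<length (S j)]"
    and per: "\<And>k. length (R i0) \<le> k \<Longrightarrow> f (k + p) = f k"
    unfolding settled_def by (metis append_self_conv)
  have nth: "S j ! k = f k" if "k < length (S j)" for k
    using that by (subst f) simp
  have dvd: "p dvd b" if "a mod p = (a + b) mod p" for a b
    using that mod_eq_dvd_iff_nat[of a "a + b" p] by simp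
  have "p dvd length y" "p dvd length x"
    using mods by (intro dvd[of "length (S i)"] dvd[of "length (R i)"]; simp only: S(1) R(1) length_append)+
  moreover have "periodic p (w @ y)"
  proof -
    have wy: "(w @ y) ! k = f (length (R i) + k)" if "k < length (w @ y)" for k
      using nth[of "length (R i) + k"] S that by (simp add: nth_append add.commute)
    have "length (R i0) \<le> length (R i)" using R(3) by (rule prefix_length_le)
    then have "f (length (R i) + (k + p)) = f (length (R i) + k)" for k
      using per[of "length (R i) + k"] by (simp add: add.assoc)
    then show ?thesis unfolding periodic_def using wy by simp
  qed
  moreover have "length x \<le> length y"
    using le arg_cong[OF S(1), of length] S(2) R(1,2) by simp
  ultimately show ?thesis using p unfolding chan_loop_def by blast
qed (simp add: chan_loop_def)

text \<open>Dickson's lemma in dimension one. \<open>J'\<close> keeps the indices whose value is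
  minimal among all later ones; the least value attained from \<open>n\<close> on occurs at such an
  index.\<close>

lemma nondecreasing_subset:
  fixes J :: "nat set" and g :: "nat \<Rightarrow> nat"
  assumes "infinite J"
  shows "\<exists>J'\<subseteq>J. infinite J' \<and> (\<forall>i\<in>J'. \<forall>j\<in>J'. i \<le> j \<longrightarrow> g i \<le> g j)"
proof -
  define J' where "J' = {i\<in>J. \<forall>j\<in>J. i \<le> j \<longrightarrow> g i \<le> g j}"
  have "\<exists>i\<ge>n. i \<in> J'" for n
  proof -
    obtain k where "n \<le> k \<and> k \<in> J" using assms infinite_nat_iff_unbounded_le by blast
    from ex_has_least_nat[of "\<lambda>k. n \<le> k \<and> k \<in> J", OF this, of g] obtain i where
      "n \<le> i \<and> i \<in> J" "\<And>j. n \<le> j \<and> j \<in> J \<Longrightarrow> g i \<le> g j" by blast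
    then show ?thesis unfolding J'_def by (blast intro: le_trans)
  qed
  then have "infinite J'" using infinite_nat_iff_unbounded_le by blast
  then show ?thesis unfolding J'_def by (intro exI[of _ J']) (auto simp: J'_def)
qed

lemma constant_subset:
  assumes "infinite J" "finite (f ` J)"
  shows "\<exists>J'\<subseteq>J. infinite J' \<and> (\<forall>i\<in>J'. \<forall>j\<in>J'. f i = f j)"
proof -
  obtain a where "infinite {i\<in>J. f i = f a}" using pigeonhole_infinite[OF assms] by blast
  then show ?thesis by (intro exI[of _ "{i\<in>J. f i = f a}"]) auto
qed

text \<open>Thinning for one channel after another; since \<open>P\<close> passes to subsets, what
  earlier channels have gained is kept.\<close>

lemma refine_infinite:
  assumes "finite C" "infinite I"
    and "\<And>c J. c \<in> C \<Longrightarrow> infinite J \<Longrightarrow> \<exists>J'\<subseteq>J. infinite J' \<and> P c J'"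
    and "\<And>c J J'. P c J \<Longrightarrow> J' \<subseteq> J \<Longrightarrow> P c J'"
  shows "\<exists>J\<subseteq>I. infinite J \<and> (\<forall>c\<in>C. P c J)"
  using assms(1,3)
proof (induction C)
  case empty
  show ?case using assms(2) by blast
next
  case (insert c C)
  then obtain J where J: "J \<subseteq> I" "infinite J" "\<forall>c\<in>C. P c J" by (metis insertCI)
  with insert.prems[of c J] obtain J' where "J' \<subseteq> J" "infinite J'" "P c J'" by blast
  with J assms(4) show ?case by (intro exI[of _ J']) blast
qed

lemma finite_mod_image: "p > 0 \<Longrightarrow> finite ((\<lambda>i. g i mod p :: nat) ` J)"
  by (rule finite_subset[of _ "{..<p}"]) auto

section \<open>Extraction of a loop from an infinite run\<close>

lemma run_steps:
  assumes "\<And>i. step M (s i) (\<alpha> i) (s (Suc i))" "i \<le> j"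
  shows "steps M (s i) (map \<alpha> [i..<j]) (s j)"
  using assms(2)
proof (induction j rule: dec_induct)
  case base
  show ?case by (simp add: steps.Nil)
next
  case (step j)
  have "map \<alpha> [i..<Suc j] = map \<alpha> [i..<j] @ [\<alpha> j]" using step.hyps by simp
  then show ?case using step.IH assms(1)[of j] steps_append steps_single by metis
qed

lemma step_wf:
  assumes "wf_fifo_machine M" "step M s \<alpha> s'"
  shows "fst s' \<in> control_states M" "fst \<alpha> \<in> channels M"
  using assms(2,1) by (cases, auto simp: wf_fifo_machine_def)+

lemma infinite_run_machine_loop:
  assumes wf: "wf_fifo_machine M" and ib: "input_bounded M"
    and start: "s 0 = initial_config M" and step: "\<And>i. step M (s i) (\<alpha> i) (s (Suc i))"
  shows "\<exists>i j q w w'. i < j \<and> s i = (q, w) \<and> s j = (q, w') \<and> machine_loop M q w (map \<alpha> [i..<j]) w'"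
proof -
  define S where "S c i = send_proj c (map \<alpha> [0..<i])" for c i
  define R where "R c i = recv_proj c (map \<alpha> [0..<i])" for c i
  have split: "map \<alpha> [0..<j] = map \<alpha> [0..<i] @ map \<alpha> [i..<j]" if "i \<le> j" for i j
    using upt_add_eq_append[of 0 i "j - i"] that by simp
  have S_split: "S c j = S c i @ send_proj c (map \<alpha> [i..<j])"
    and R_split: "R c j = R c i @ recv_proj c (map \<alpha> [i..<j])" if "i \<le> j" for c i j
    by (simp_all add: S_def R_def split[OF that])
  have S_mono: "prefix (S c i) (S c j)" and R_mono: "prefix (R c i) (R c j)" if "i \<le> j" for c i j
    by (simp_all add: S_split[OF that] R_split[OF that])
  note run = run_steps[of M s \<alpha>, OF step]
  have content: "S c i = R c i @ snd (s i) c" for c i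
    using steps_content[OF run[of 0 i], of c] start by (simp add: S_def R_def initial_config_def)
  have "\<exists>i0 p. settled (S c) (R c) i0 p" if c: "c \<in> channels M" for c
  proof -
    from ib c obtain ws where ws: "\<forall>\<sigma>\<in>traces M. \<exists>u\<in>bounded_lang ws. prefix (send_proj c \<sigma>) u"
      unfolding input_bounded_def by blast
    have "map \<alpha> [0..<i] \<in> traces M" for i
      using run[of 0 i] start unfolding traces_def by fastforce
    with ws have "\<exists>u\<in>bounded_lang ws. prefix (S c i) u" for i unfolding S_def by blast
    from settled_exists[of "S c" "R c", OF S_mono R_mono _ this] show ?thesis
      by (simp add: content)
  qed
  then obtain i0 p where settled: "\<And>c. c \<in> channels M \<Longrightarrow> settled (S c) (R c) (i0 c) (p c)"
    by metis
  have fin: "finite (channels M)" using wf by (simp add: wf_fifo_machine_def)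
  \<comment> \<open>The sum is a common upper bound of the settling times, and
    \<open>settled_mono\<close> allows the delay.\<close>
  define m where "m = (\<Sum>c\<in>channels M. i0 c)"
  have m: "settled (S c) (R c) m (p c)" if "c \<in> channels M" for c
    using settled_mono[OF settled[OF that] _ R_mono] fin that
    by (simp add: m_def member_le_sum)
  have "fst (s i) \<in> control_states M" for i
    using start wf step_wf(1)[OF wf step]
    by (cases i) (auto simp: initial_config_def wf_fifo_machine_def)
  then have "finite ((\<lambda>i. fst (s i)) ` {m..})"
    using wf by (auto simp: wf_fifo_machine_def intro: finite_subset)
  from constant_subset[OF infinite_Ici this] obtain I where
    I: "I \<subseteq> {m..}" "infinite I" "\<forall>i\<in>I. \<forall>j\<in>I. fst (s i) = fst (s j)" by blast
  \<comment> \<open>The phase of a channel consists of the residues of |R| and |S|, the positions in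
    the sent word where the content begins and ends.\<close>
  define P where "P c J \<longleftrightarrow> (\<forall>i\<in>J. \<forall>j\<in>J.
      length (S c i) mod p c = length (S c j) mod p c \<and> length (R c i) mod p c = length (R c j) mod p c \<and>
      (i \<le> j \<longrightarrow> length (snd (s i) c) \<le> length (snd (s j) c)))" for c J
  have "\<exists>J'\<subseteq>J. infinite J' \<and> P c J'" if c: "c \<in> channels M" and J: "infinite J" for c J
  proof -
    have p: "p c > 0" using settled[OF c] by (simp add: settled_def)
    from constant_subset[OF J finite_mod_image[OF p, of "\<lambda>i. length (S c i)"]] obtain J1 where J1: "J1 \<subseteq> J" "infinite J1"
      "\<forall>i\<in>J1. \<forall>j\<in>J1. length (S c i) mod p c = length (S c j) mod p c" by blast
    from constant_subset[OF J1(2) finite_mod_image[OF p, of "\<lambda>i. length (R c i)"]] obtain J2 where J2: "J2 \<subseteq> J1" "infinite J2"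
      "\<forall>i\<in>J2. \<forall>j\<in>J2. length (R c i) mod p c = length (R c j) mod p c" by blast
    from nondecreasing_subset[OF J2(2), of "\<lambda>i. length (snd (s i) c)"] obtain J3 where
      J3: "J3 \<subseteq> J2" "infinite J3"
      "\<forall>i\<in>J3. \<forall>j\<in>J3. i \<le> j \<longrightarrow> length (snd (s i) c) \<le> length (snd (s j) c)" by blast
    have "P c J3" unfolding P_def using J1(3) J2(1,3) J3(1,3) by blast
    with J1 J2 J3 show ?thesis by (intro exI[of _ J3]) blast
  qed
  moreover have "P c J'" if "P c J" "J' \<subseteq> J" for c J J'
    using that unfolding P_def by blast
  ultimately obtain J where J: "J \<subseteq> I" "infinite J" "\<forall>c\<in>channels M. P c J"
    using refine_infinite[OF fin I(2), of P] by blast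
  from J(2) obtain i where i: "i \<in> J" using infinite_imp_nonempty by blast
  from J(2) obtain j where j: "j \<in> J" "i < j" using infinite_nat_iff_unbounded by blast
  have ge: "m \<le> i" "m \<le> j" using i j I J by auto
  have "chan_loop (snd (s i) c) (recv_proj c (map \<alpha> [i..<j])) (send_proj c (map \<alpha> [i..<j]))" for c
  proof (cases "c \<in> channels M")
    case True
    then have "P c J" using J(3) by blast
    then show ?thesis
      using settled_chan_loop[OF m[OF True] ge S_split content R_split content R_mono[OF ge(1)]] i j
      unfolding P_def by (metis less_imp_le)
  next
    case False
    have "fst (\<alpha> k) \<noteq> c" for k using step_wf(2)[OF wf step] False by blast
    then have "recv_proj c (map \<alpha> ks) = []" for ks
      by (auto simp: recv_proj_def split: prod.splits) (metis fst_conv)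
    then show ?thesis by (simp add: chan_loop_def)
  qed
  moreover have "fst (s i) = fst (s j)" using i j I J by blast
  then obtain q w w' where "s i = (q, w)" "s j = (q, w')" by (metis prod.collapse)
  ultimately show ?thesis
    unfolding machine_loop_def using run[of i j] j(2)
    by (intro exI[of _ i] exI[of _ j] exI[of _ q] exI[of _ w] exI[of _ w']) simp
qed


section \<open>Finite closures of runs\<close>

text \<open>The path follows points with infinitely many descendants. It may revisit points in
  general; in both applications \<open>r\<close> raises a counter, the time or the distance from the
  start, which excludes this.\<close>

lemma koenig:
  assumes fin: "\<And>x. finite {y. r x y}" and inf: "infinite {y. r\<^sup>*\<^sup>* x y}"
  shows "\<exists>f :: nat \<Rightarrow> 'a. f 0 = x \<and> (\<forall>i. r (f i) (f (Suc i)))"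
proof -
  have "\<exists>x'. infinite {y. r\<^sup>*\<^sup>* x' y} \<and> r x x'" if "infinite {y. r\<^sup>*\<^sup>* x y}" for x
  proof (rule ccontr)
    assume "\<not> ?thesis"
    then have "finite (insert x (\<Union>x'\<in>{x'. r x x'}. {y. r\<^sup>*\<^sup>* x' y}))" using fin by auto
    moreover have "{y. r\<^sup>*\<^sup>* x y} \<subseteq> insert x (\<Union>x'\<in>{x'. r x x'}. {y. r\<^sup>*\<^sup>* x' y})"
      by (auto elim: converse_rtranclpE)
    ultimately show False using that finite_subset by blast
  qed
  then have "\<exists>f. \<forall>n. (infinite {y. r\<^sup>*\<^sup>* (f n) y} \<and> (n = 0 \<longrightarrow> f n = x)) \<and> r (f n) (f (Suc n))"
    using inf by (intro dependent_nat_choice) auto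
  then show ?thesis by blast
qed

lemma finite_successors:
  assumes "wf_fifo_machine M"
  shows "finite {s'. \<exists>\<alpha>. step M s \<alpha> s'}"
proof (rule finite_subset)
  \<comment> \<open>For disabled transitions the value is meaningless, which does no harm in a
    finite superset.\<close>
  let ?succ = "\<lambda>(q, (c, d, a), q'). (q', (snd s)(c := if d = Send then snd s c @ [a] else tl (snd s c)))"
  show "{s'. \<exists>\<alpha>. step M s \<alpha> s'} \<subseteq> ?succ ` transitions M"
    by (force elim: step.cases)
  show "finite (?succ ` transitions M)" using finite_transitions[OF assms] by blast
qed

text \<open>With \<delta> = 1 the rank is the time, and finiteness means termination even though a
  run may cycle through finitely many configurations. With \<delta> = 0 the rank is always 0,
  leaving a copy of \<open>reachable M\<close>.\<close>

definition ranked :: "nat \<Rightarrow> ('q, 'c, 'a) fifo_machine \<Rightarrow> (nat \<times> ('q, 'c, 'a) config) set" where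
  "ranked \<delta> M = {(\<delta> * length \<sigma>, s) |\<sigma> s. steps M (initial_config M) \<sigma> s}"

lemma rankedI: "steps M (initial_config M) \<sigma> s \<Longrightarrow> (\<delta> * length \<sigma>, s) \<in> ranked \<delta> M"
  unfolding ranked_def by blast

lemma ranked_closed:
  assumes "(i, s) \<in> ranked \<delta> M" "step M s \<alpha> s'"
  shows "(i + \<delta>, s') \<in> ranked \<delta> M"
proof -
  from assms obtain \<sigma> where \<sigma>: "i = \<delta> * length \<sigma>" "steps M (initial_config M) \<sigma> s"
    unfolding ranked_def by blast
  then have "steps M (initial_config M) (\<sigma> @ [\<alpha>]) s'"
    using assms(2) steps_append steps_single by metis
  moreover have "i + \<delta> = \<delta> * length (\<sigma> @ [\<alpha>])" using \<sigma> by simp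
  ultimately show ?thesis unfolding ranked_def by blast
qed

lemma ranked_subset:
  assumes "(0, initial_config M) \<in> C"
    and "\<And>i s \<alpha> s'. (i, s) \<in> C \<Longrightarrow> step M s \<alpha> s' \<Longrightarrow> (i + \<delta>, s') \<in> C"
  shows "ranked \<delta> M \<subseteq> C"
proof -
  have "(\<delta> * length \<sigma>, s) \<in> C" if "steps M (initial_config M) \<sigma> s" for \<sigma> s
    using that
  proof (induction \<sigma> arbitrary: s rule: rev_induct)
    case Nil
    then show ?case using assms(1) by (auto elim: steps.cases)
  next
    case (snoc \<alpha> \<sigma>)
    then obtain t where t: "steps M (initial_config M) \<sigma> t" "step M t \<alpha> s"
      unfolding steps_append steps_single by blast
    from assms(2)[OF snoc.IH[OF t(1)] t(2)] show ?case by (simp add: add.commute)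
  qed
  then show ?thesis unfolding ranked_def by blast
qed

lemma ranked_0: "finite (ranked 0 M) \<longleftrightarrow> bounded_machine M"
proof -
  have "ranked 0 M = Pair 0 ` reachable M" unfolding ranked_def reachable_def by auto
  then show ?thesis by (simp add: bounded_machine_def finite_image_iff inj_on_def)
qed

text \<open>An infinite run meets every rank. Conversely, timed configurations branch finitely, so
  infinitely many of them contain an infinite path.\<close>

lemma ranked_1:
  assumes "wf_fifo_machine M"
  shows "finite (ranked 1 M) \<longleftrightarrow> \<not> nonterminating M"
proof
  assume fin: "finite (ranked 1 M)"
  show "\<not> nonterminating M"
  proof
    assume "nonterminating M"
    then obtain s \<alpha> where s: "s 0 = initial_config M" "\<And>i. step M (s i) (\<alpha> i) (s (Suc i))"
      unfolding nonterminating_def by blast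
    have "i \<in> fst ` ranked 1 M" for i
    proof -
      have "steps M (initial_config M) (map \<alpha> [0..<i]) (s i)"
        using run_steps[of M s \<alpha> 0 i, OF s(2)] s(1) by simp
      from rankedI[OF this, of 1] show ?thesis by (metis diff_zero fst_conv image_eqI length_map length_upt mult_1)
    qed
    then have "fst ` ranked 1 M = UNIV" by blast
    with fin show False by (metis finite_imageI infinite_UNIV_nat)
  qed
next
  assume no_run: "\<not> nonterminating M"
  define r where "r x y \<longleftrightarrow> (\<exists>\<alpha>. step M (snd x) \<alpha> (snd y)) \<and> fst y = Suc (fst x)"
    for x y :: "nat \<times> ('a, 'b, 'c) config"
  show "finite (ranked 1 M)"
  proof (rule ccontr)
    assume "infinite (ranked 1 M)"
    moreover have "ranked 1 M \<subseteq> {y. r\<^sup>*\<^sup>* (0, initial_config M) y}"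
    proof (rule ranked_subset)
      fix i s \<alpha> s'
      assume "(i, s) \<in> {y. r\<^sup>*\<^sup>* (0, initial_config M) y}" "step M s \<alpha> s'"
      moreover from this(2) have "r (i, s) (i + 1, s')"
        unfolding r_def fst_conv snd_conv Suc_eq_plus1 by blast
      ultimately show "(i + 1, s') \<in> {y. r\<^sup>*\<^sup>* (0, initial_config M) y}" by simp
    qed simp
    ultimately have inf: "infinite {y. r\<^sup>*\<^sup>* (0, initial_config M) y}" using finite_subset by blast
    have "{y. r x y} = Pair (Suc (fst x)) ` {s'. \<exists>\<alpha>. step M (snd x) \<alpha> s'}" for x
      unfolding r_def by force
    then have "finite {y. r x y}" for x using finite_successors[OF assms] by simp
    from koenig[of r, OF this inf] obtain f where
      f: "f 0 = (0, initial_config M)" "\<And>i. r (f i) (f (Suc i))" by blast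
    then have "\<forall>i. \<exists>\<alpha>. step M (snd (f i)) \<alpha> (snd (f (Suc i)))" unfolding r_def by blast
    from choice[OF this] obtain \<alpha> where "\<forall>i. step M (snd (f i)) (\<alpha> i) (snd (f (Suc i)))" ..
    moreover have "snd (f 0) = initial_config M" by (simp add: f(1))
    ultimately have "nonterminating M"
      unfolding nonterminating_def by (intro exI[of _ "\<lambda>i. snd (f i)"] exI[of _ \<alpha>] conjI)
    with no_run show False by contradiction
  qed
qed

text \<open>Turns the iterates of a loop, which are arbitrarily long finite runs, into an infinite
  run without gluing them together.\<close>

lemma nonterminating_if_unbounded_traces:
  assumes "wf_fifo_machine M" "\<And>n. \<exists>\<sigma>\<in>traces M. n \<le> length \<sigma>"
  shows "nonterminating M"
proof (rule ccontr)
  assume "\<not> nonterminating M"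
  then have "finite (fst ` ranked 1 M)" using ranked_1[OF assms(1)] by blast
  then obtain N where N: "\<And>n. n \<in> fst ` ranked 1 M \<Longrightarrow> n < N"
    by (meson finite_nat_set_iff_bounded)
  from assms(2)[of N] obtain \<sigma> s where "N \<le> length \<sigma>" "steps M (initial_config M) \<sigma> s"
    unfolding traces_def by blast
  with N[of "length \<sigma>"] rankedI[of M \<sigma> s 1] show False
    by (metis fst_conv image_eqI mult_1 not_le)
qed

text \<open>Following an infinite branch of the breadth-first search tree avoids repetitions.\<close>

lemma unbounded_injective_run:
  assumes wf: "wf_fifo_machine M" and unbounded: "\<not> bounded_machine M"
  shows "\<exists>s \<alpha>. s 0 = initial_config M \<and> (\<forall>i. step M (s i) (\<alpha> i) (s (Suc i))) \<and> inj s"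
proof -
  define at where "at n s \<longleftrightarrow> (\<exists>\<sigma>. length \<sigma> = n \<and> steps M (initial_config M) \<sigma> s)" for n s
  define dist where "dist s = (LEAST n. at n s)" for s
  \<comment> \<open>Only steps that lead one level further from the initial configuration
    count.\<close>
  define r where "r s s' \<longleftrightarrow> (\<exists>\<alpha>. step M s \<alpha> s') \<and> dist s' = Suc (dist s)" for s s'
  have at_Suc: "at (Suc n) s' \<longleftrightarrow> (\<exists>s \<alpha>. at n s \<and> step M s \<alpha> s')" for n s'
  proof
    assume "at (Suc n) s'"
    then obtain \<sigma> where "length \<sigma> = Suc n" "steps M (initial_config M) \<sigma> s'" unfolding at_def by blast
    then obtain \<tau> \<alpha> where "length \<tau> = n" "steps M (initial_config M) (\<tau> @ [\<alpha>]) s'"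
      by (metis length_append_singleton length_Suc_conv_rev nat.inject)
    then show "\<exists>s \<alpha>. at n s \<and> step M s \<alpha> s'"
      unfolding at_def steps_append steps_single by blast
  next
    assume "\<exists>s \<alpha>. at n s \<and> step M s \<alpha> s'"
    then obtain \<sigma> s \<alpha> where "length \<sigma> = n" "steps M (initial_config M) \<sigma> s" "step M s \<alpha> s'"
      unfolding at_def by blast
    then have "length (\<sigma> @ [\<alpha>]) = Suc n" "steps M (initial_config M) (\<sigma> @ [\<alpha>]) s'"
      unfolding steps_append steps_single by (simp, blast)
    then show "at (Suc n) s'" unfolding at_def by blast
  qed
  have at_0: "at 0 s \<longleftrightarrow> s = initial_config M" for s
    unfolding at_def by (auto intro: steps.Nil elim: steps.cases)
  \<comment> \<open>The last but one configuration of a shortest run has distance exactly one less,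
    so every reachable configuration is linked to the initial one through \<open>r\<close>.\<close>
  have geodesic: "r\<^sup>*\<^sup>* (initial_config M) s" if "at n s" "dist s = n" for n s
    using that
  proof (induction n arbitrary: s)
    case 0
    then show ?case by (simp add: at_0)
  next
    case (Suc n)
    then obtain t \<alpha> where t: "at n t" "step M t \<alpha> s" using at_Suc by blast
    have "dist t \<le> n" unfolding dist_def using t(1) by (rule Least_le)
    moreover have "at (dist t) t" unfolding dist_def using t(1) by (rule LeastI)
    then have "at (Suc (dist t)) s" using t(2) at_Suc by blast
    then have "dist s \<le> Suc (dist t)" unfolding dist_def[of s] by (rule Least_le)
    ultimately have "dist t = n" using Suc.prems(2) by simp
    then have "r t s" using t(2) Suc.prems(2) unfolding r_def by blast
    with Suc.IH[OF t(1) \<open>dist t = n\<close>] show ?case by (rule rtranclp.rtrancl_into_rtrancl)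
  qed
  have "r\<^sup>*\<^sup>* (initial_config M) s" if "at n s" for n s
  proof (rule geodesic[OF _ refl])
    show "at (dist s) s" unfolding dist_def using that by (rule LeastI)
  qed
  then have "reachable M \<subseteq> {s. r\<^sup>*\<^sup>* (initial_config M) s}"
    unfolding reachable_def at_def by blast
  then have inf: "infinite {s. r\<^sup>*\<^sup>* (initial_config M) s}"
    using unbounded finite_subset unfolding bounded_machine_def by blast
  have "finite {s'. r s s'}" for s
    by (rule finite_subset[OF _ finite_successors[OF wf, of s]]) (auto simp: r_def)
  from koenig[of r, OF this inf] obtain s where
    s: "s 0 = initial_config M" "\<And>i. r (s i) (s (Suc i))" by blast
  \<comment> \<open>The distance identifies the position in the run, whence injectivity.\<close>
  have "dist (s i) = dist (s 0) + i" for i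
    using s(2) by (induction i) (auto simp: r_def)
  then have "i = j" if "s i = s j" for i j using that by (metis add_left_cancel)
  then have "inj s" by (rule injI)
  moreover have "\<forall>i. \<exists>\<alpha>. step M (s i) \<alpha> (s (Suc i))" using s(2) unfolding r_def by blast
  ultimately show ?thesis using s(1) choice[of "\<lambda>i \<alpha>. step M (s i) \<alpha> (s (Suc i))"] by blast
qed

section \<open>Loops as witnesses of non-termination and unboundedness\<close>

lemma nonterminating_iff_loop:
  assumes "wf_fifo_machine M" "input_bounded M"
  shows "nonterminating M \<longleftrightarrow>
    (\<exists>\<sigma>\<^sub>0 q w \<sigma> w'. steps M (initial_config M) \<sigma>\<^sub>0 (q, w) \<and> machine_loop M q w \<sigma> w')"
proof
  assume "nonterminating M"
  then obtain s \<alpha> where s: "s 0 = initial_config M" "\<And>i. step M (s i) (\<alpha> i) (s (Suc i))"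
    unfolding nonterminating_def by blast
  from infinite_run_machine_loop[OF assms s] obtain i j q w w' where
    "s i = (q, w)" "machine_loop M q w (map \<alpha> [i..<j]) w'" by blast
  moreover have "steps M (initial_config M) (map \<alpha> [0..<i]) (s i)"
    using run_steps[of M s \<alpha> 0 i, OF s(2)] s(1) by simp
  ultimately show "\<exists>\<sigma>\<^sub>0 q w \<sigma> w'. steps M (initial_config M) \<sigma>\<^sub>0 (q, w) \<and> machine_loop M q w \<sigma> w'"
    by metis
next
  assume "\<exists>\<sigma>\<^sub>0 q w \<sigma> w'. steps M (initial_config M) \<sigma>\<^sub>0 (q, w) \<and> machine_loop M q w \<sigma> w'"
  then obtain \<sigma>\<^sub>0 q w \<sigma> w' where run: "steps M (initial_config M) \<sigma>\<^sub>0 (q, w)"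
    and loop: "machine_loop M q w \<sigma> w'" by blast
  show "nonterminating M"
  proof (rule nonterminating_if_unbounded_traces[OF assms(1)])
    fix n
    obtain v where "steps M (q, w) (concat (replicate n \<sigma>)) (q, v)"
      using machine_loop_iterate[OF loop] by blast
    with run have "\<sigma>\<^sub>0 @ concat (replicate n \<sigma>) \<in> traces M"
      unfolding traces_def using steps_append by blast
    moreover have "n \<le> length (\<sigma>\<^sub>0 @ concat (replicate n \<sigma>))"
      using loop unfolding machine_loop_def
      by (cases \<sigma>) (auto simp: length_concat_replicate)
    ultimately show "\<exists>\<sigma>\<in>traces M. n \<le> length \<sigma>" by blast
  qed
qed

lemma unbounded_iff_loop:
  assumes "wf_fifo_machine M" "input_bounded M"
  shows "\<not> bounded_machine M \<longleftrightarrow>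
    (\<exists>\<sigma>\<^sub>0 q w \<sigma> w'. steps M (initial_config M) \<sigma>\<^sub>0 (q, w) \<and> machine_loop M q w \<sigma> w' \<and> w \<noteq> w')"
proof
  assume "\<not> bounded_machine M"
  from unbounded_injective_run[OF assms(1) this] obtain s \<alpha> where
    s: "s 0 = initial_config M" "\<And>i. step M (s i) (\<alpha> i) (s (Suc i))" and inj: "inj s" by blast
  from infinite_run_machine_loop[OF assms s] obtain i j q w w' where
    ij: "i < j" "s i = (q, w)" "s j = (q, w')" "machine_loop M q w (map \<alpha> [i..<j]) w'" by blast
  moreover have "steps M (initial_config M) (map \<alpha> [0..<i]) (s i)"
    using run_steps[of M s \<alpha> 0 i, OF s(2)] s(1) by simp
  moreover have "w \<noteq> w'" using inj ij(1-3) by (metis injD less_irrefl)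
  ultimately show "\<exists>\<sigma>\<^sub>0 q w \<sigma> w'. steps M (initial_config M) \<sigma>\<^sub>0 (q, w) \<and> machine_loop M q w \<sigma> w' \<and> w \<noteq> w'"
    by metis
next
  assume "\<exists>\<sigma>\<^sub>0 q w \<sigma> w'. steps M (initial_config M) \<sigma>\<^sub>0 (q, w) \<and> machine_loop M q w \<sigma> w' \<and> w \<noteq> w'"
  then obtain \<sigma>\<^sub>0 q w \<sigma> w' where run: "steps M (initial_config M) \<sigma>\<^sub>0 (q, w)"
    and loop: "machine_loop M q w \<sigma> w'" and "w \<noteq> w'" by blast
  from machine_loop_grows[OF loop \<open>w \<noteq> w'\<close>] obtain c where
    c: "length (recv_proj c \<sigma>) < length (send_proj c \<sigma>)" by blast
  have "\<exists>n \<in> (\<lambda>s. length (snd s c)) ` reachable M. k \<le> n" for k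
  proof -
    obtain v where v: "steps M (q, w) (concat (replicate k \<sigma>)) (q, v)"
      "length (v c) + k * length (recv_proj c \<sigma>) = length (w c) + k * length (send_proj c \<sigma>)"
      using machine_loop_iterate[OF loop] by blast
    have "k * Suc (length (recv_proj c \<sigma>)) \<le> k * length (send_proj c \<sigma>)"
      using c by (intro mult_le_mono2) simp
    then have "k \<le> length (v c)" using v(2) by simp
    moreover have "(q, v) \<in> reachable M"
      using run v(1) steps_append unfolding reachable_def by blast
    ultimately show ?thesis by force
  qed
  then have "infinite ((\<lambda>s. length (snd s c)) ` reachable M)"
    unfolding infinite_nat_iff_unbounded_le by blast
  then show "\<not> bounded_machine M" unfolding bounded_machine_def by blast
qed

section \<open>Certificates for coded machines\<close>

definition conf_code :: "nat \<Rightarrow> (nat, nat, nat) config \<Rightarrow> nat" where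
  "conf_code N s = tab (\<lambda>i. if i = 0 then fst s else list_encode (snd s (i - 1))) (Suc N)"

text \<open>An action leaves the target state open, whereas a transition determines it. Lists of
  transitions therefore make runs deterministic, and a partial function can evaluate them.\<close>

fun tstep :: "'q \<times> ('c, 'a) action \<times> 'q \<Rightarrow> ('q, 'c, 'a) config \<Rightarrow> ('q, 'c, 'a) config option" where
  "tstep (q, (c, d, a), q') (p, w) =
     (if p \<noteq> q then None
      else if d = Send then Some (q', w(c := w c @ [a]))
      else if w c \<noteq> [] \<and> hd (w c) = a then Some (q', w(c := tl (w c))) else None)"

fun trun :: "('q, 'c, 'a) config \<Rightarrow> ('q \<times> ('c, 'a) action \<times> 'q) list \<Rightarrow> ('q, 'c, 'a) config option" where
  "trun s [] = Some s"
| "trun s (t # ts) = Option.bind (tstep t s) (\<lambda>s'. trun s' ts)"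

definition act :: "'q \<times> ('c, 'a) action \<times> 'q \<Rightarrow> ('c, 'a) action" where "act t = fst (snd t)"

lemma dir_neq_Send [simp]: "d \<noteq> Send \<longleftrightarrow> d = Receive"
  by (cases d) simp_all

lemma step_iff_tstep: "step M s \<alpha> s' \<longleftrightarrow> (\<exists>t\<in>transitions M. act t = \<alpha> \<and> tstep t s = Some s')"
proof
  assume "step M s \<alpha> s'"
  then show "\<exists>t\<in>transitions M. act t = \<alpha> \<and> tstep t s = Some s'"
    by cases (force simp: act_def)+
next
  assume "\<exists>t\<in>transitions M. act t = \<alpha> \<and> tstep t s = Some s'"
  then obtain q c d a q' where t: "(q, (c, d, a), q') \<in> transitions M" "\<alpha> = (c, d, a)"
    "tstep (q, (c, d, a), q') s = Some s'"
    by (force simp: act_def)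
  obtain w where s: "s = (q, w)" using t(3) by (cases s) (auto split: if_splits)
  show "step M s \<alpha> s'"
  proof (cases d)
    case Send
    then show ?thesis using t s step.send[of q c a q' M w] by simp
  next
    case Receive
    then show ?thesis using t s step.receive[of q c a q' M w "tl (w c)"]
      by (cases "w c") (auto split: if_splits)
  qed
qed

lemma steps_iff_trun:
  "steps M s \<sigma> s' \<longleftrightarrow> (\<exists>ts. set ts \<subseteq> transitions M \<and> map act ts = \<sigma> \<and> trun s ts = Some s')"
proof
  assume "steps M s \<sigma> s'"
  then show "\<exists>ts. set ts \<subseteq> transitions M \<and> map act ts = \<sigma> \<and> trun s ts = Some s'"
  proof (induction rule: steps.induct)
    case (Nil s)
    show ?case by (intro exI[of _ "[]"]) simp
  next
    case (Cons s \<alpha> s' \<sigma> s'')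
    then obtain t ts where "t \<in> transitions M" "act t = \<alpha>" "tstep t s = Some s'"
      "set ts \<subseteq> transitions M" "map act ts = \<sigma>" "trun s' ts = Some s''"
      unfolding step_iff_tstep by blast
    then show ?case by (intro exI[of _ "t # ts"]) simp
  qed
next
  assume "\<exists>ts. set ts \<subseteq> transitions M \<and> map act ts = \<sigma> \<and> trun s ts = Some s'"
  then obtain ts where "set ts \<subseteq> transitions M" "map act ts = \<sigma>" "trun s ts = Some s'" by blast
  then show "steps M s \<sigma> s'"
  proof (induction ts arbitrary: s \<sigma>)
    case Nil
    then show ?case by (auto intro: steps.Nil)
  next
    case (Cons t ts)
    from Cons.prems(3) obtain r where r: "tstep t s = Some r" "trun r ts = Some s'"
      by (auto simp: bind_eq_Some_conv)
    then have "step M s (act t) r" unfolding step_iff_tstep using Cons.prems(1) by auto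
    moreover have "steps M r (map act ts) s'" using Cons r by simp
    ultimately show ?case using Cons.prems(2) by (auto intro: steps.Cons)
  qed
qed

section \<open>Agreement of the coded operations with machine steps\<close>

lemma tab_cong: "(\<And>i. i < n \<Longrightarrow> f i = g i) \<Longrightarrow> tab f n = tab g n"
  unfolding tab_def by (rule arg_cong[of _ _ list_encode]) simp

lemma lenc_conf [simp]: "lenc (conf_code N s) = Suc N"
  and nthc_conf_0 [simp]: "nthc (conf_code N s) 0 = fst s"
  and nthc_conf_Suc [simp]: "c < N \<Longrightarrow> nthc (conf_code N s) (Suc c) = list_encode (snd s c)"
  by (simp_all add: conf_code_def)

text \<open>The code forgets all channels from \<open>N\<close> on, so they have to be empty on both
  sides.\<close>

lemma conf_code_inject:
  assumes "conf_code N s = conf_code N s'" "\<And>c. N \<le> c \<Longrightarrow> snd s c = [] \<and> snd s' c = []"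
  shows "s = s'"
proof (rule prod_eqI)
  show "fst s = fst s'" using arg_cong[OF assms(1), of "\<lambda>z. nthc z 0"] by simp
  show "snd s = snd s'"
  proof
    fix c
    show "snd s c = snd s' c"
      using arg_cong[OF assms(1), of "\<lambda>z. nthc z (Suc c)"] assms(2)[of c]
      by (cases "c < N") (auto simp: list_encode_eq)
  qed
qed

lemma snocc_list_encode [simp]: "snocc (list_encode xs) a = list_encode (xs @ [a])"
proof -
  have "map (\<lambda>i. if i < length xs then nthc (list_encode xs) i else a) [0..<Suc (length xs)] = xs @ [a]"
    by (rule nth_equalityI) (auto simp: nth_append simp del: upt_Suc)
  then show ?thesis by (simp add: snocc_def tab_def)
qed

lemma updc_conf:
  "updc (conf_code N s) q' c (list_encode v) = conf_code N (q', (snd s)(c := v))"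
  unfolding updc_def conf_code_def[of N "(q', (snd s)(c := v))"]
proof (simp only: lenc_conf, rule tab_cong)
  fix i assume "i < Suc N"
  then show "(if i = 0 then q' else if i = Suc c then list_encode v else nthc (conf_code N s) i) =
      (if i = 0 then fst (q', (snd s)(c := v)) else list_encode (snd (q', (snd s)(c := v)) (i - 1)))"
    by (cases i) auto
qed

lemma fields_transition_code [simp]:
  "src (transition_code (q, (c, d, a), q')) = q"
  "chan (transition_code (q, (c, d, a), q')) = c"
  "dirn (transition_code (q, (c, d, a), q')) = dir_code d"
  "msg (transition_code (q, (c, d, a), q')) = a"
  "tgt (transition_code (q, (c, d, a), q')) = q'"
  by (simp_all add: src_def chan_def dirn_def msg_def tgt_def)

lemma sendc_conf:
  "c < N \<Longrightarrow> sendc (conf_code N s) (transition_code (q, (c, d, a), q')) =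
     conf_code N (q', (snd s)(c := snd s c @ [a]))"
  by (simp add: sendc_def updc_conf del: transition_code.simps)

definition opt_code :: "nat \<Rightarrow> (nat, nat, nat) config option \<Rightarrow> nat" where
  "opt_code N x = (case x of None \<Rightarrow> 0 | Some s \<Rightarrow> Suc (conf_code N s))"

lemma opt_code_simps [simp]:
  "opt_code N None = 0" "opt_code N (Some s) = Suc (conf_code N s)"
  by (simp_all add: opt_code_def)

lemma opt_code_eq_0 [simp]: "opt_code N x = 0 \<longleftrightarrow> x = None"
  by (cases x) simp_all

lemma stepc_conf:
  assumes "fst (act t) < N"
  shows "stepc (conf_code N s) (transition_code t) = opt_code N (tstep t s)"
proof -
  obtain q c d a q' where t: "t = (q, (c, d, a), q')" by (cases t) auto
  have c: "c < N" using assms by (simp add: t act_def)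
  obtain p w where s: "s = (p, w)" by (cases s)
  have upd: "updc (conf_code N (p, w)) q' c (list_encode v) = conf_code N (q', w(c := v))" for p w v
    using updc_conf[of N "(p, w)"] by simp
  show ?thesis
    using sendc_conf[OF c, of s q d a q'] c
    by (cases d; cases "w c")
      (auto simp: t s stepc_def upd simp del: transition_code.simps list_encode.simps(2))
qed

lemma runc_conf:
  assumes "\<And>t. t \<in> set ts \<Longrightarrow> fst (act t) < N"
  shows "runc (conf_code N s) (list_encode (map transition_code ts)) = opt_code N (trun s ts)"
proof -
  let ?F = "\<lambda>s t. if s = 0 then 0 else stepc (s - 1) t"
  have 0: "foldl ?F 0 xs = 0" for xs by (induction xs) auto
  have "foldl ?F (Suc (conf_code N s)) (map transition_code ts) = opt_code N (trun s ts)"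
    using assms
  proof (induction ts arbitrary: s)
    case (Cons t ts)
    then show ?case by (cases "tstep t s") (simp_all add: stepc_conf 0)
  qed simp
  then show ?thesis by (simp add: runc_def foldc_list_encode)
qed

text \<open>\<open>sendc\<close> moves to the target of a send without checking its source, so the
  resulting control state carries no information; only the contents are used.\<close>

lemma sendsc_conf:
  assumes "\<And>t. t \<in> set ts \<Longrightarrow> fst (act t) < N"
  shows "\<exists>q. sendsc (conf_code N s) (list_encode (map transition_code ts)) =
    conf_code N (q, \<lambda>c. snd s c @ send_proj c (map act ts))"
proof -
  let ?F = "\<lambda>s t. if dirn t = 0 then sendc s t else s"
  have "\<exists>q. foldl ?F (conf_code N s) (map transition_code ts) =
    conf_code N (q, \<lambda>c. snd s c @ send_proj c (map act ts))"
    using assms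
  proof (induction ts arbitrary: s)
    case Nil
    show ?case by (intro exI[of _ "fst s"]) simp
  next
    case (Cons t ts)
    obtain q c d a q' where t: "t = (q, (c, d, a), q')" by (cases t) auto
    have c: "c < N" using Cons.prems[of t] by (simp add: t act_def)
    define s' where "s' = (if d = Send then (q', (snd s)(c := snd s c @ [a])) else s)"
    have "?F (conf_code N s) (transition_code t) = conf_code N s'"
      using sendc_conf[OF c, of s q d a q'] by (cases d) (auto simp: t s'_def simp del: transition_code.simps)
    moreover have "(\<lambda>c. snd s' c @ send_proj c (map act ts)) = (\<lambda>c. snd s c @ send_proj c (map act (t # ts)))"
      by (cases d) (auto simp: s'_def t act_def fun_eq_iff)
    ultimately show ?case using Cons.IH[of s'] Cons.prems by simp
  qed
  then show ?thesis by (simp add: sendsc_def foldc_list_encode)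
qed

lemma dvdc_iff [simp]: "dvdc p n \<longleftrightarrow> p dvd n"
proof (cases "n = 0")
  case False
  show ?thesis
  proof
    assume "p dvd n"
    then obtain k where k: "n = p * k" ..
    then have "k < Suc n" using False by (cases p) auto
    with k show "dvdc p n" unfolding dvdc_def by (auto intro: exI[of _ k])
  qed (auto simp: dvdc_def)
qed (auto simp: dvdc_def)

lemma periodicc_iff [simp]: "periodicc p (list_encode u) \<longleftrightarrow> periodic p u"
  unfolding periodicc_def periodic_def by auto

lemma chanc_iff:
  assumes "w @ y = x @ w'"
  shows "chanc (list_encode w) (list_encode w') (list_encode (w @ y)) \<longleftrightarrow> chan_loop w x y"
proof -
  have len: "length w + length y = length x + length w'"
    using arg_cong[OF assms, of length] by simp
  have "length w + length y = length w' \<longleftrightarrow> x = []" "length w \<le> length w' \<longleftrightarrow> length x \<le> length y"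
    using len by auto
  moreover have "length w + length y - length w' = length x" using len by simp
  \<comment> \<open>The bounded search misses no period: \<open>p\<close> divides |x| > 0, so it is
    at most |x|, and x is a prefix of \<open>w @ y\<close>.\<close>
  moreover have "p < Suc (length w + length y)" if "x \<noteq> []" "p dvd length x" for p
    using dvd_imp_le[OF that(2)] that(1) len by simp
  ultimately show ?thesis unfolding chanc_def chan_loop_def by auto
qed

section \<open>Correctness of the certificates for a fixed machine\<close>

context
  fixes M :: "(nat, nat, nat) fifo_machine"
  assumes wf: "wf_fifo_machine M"
begin

abbreviation "T \<equiv> trans_of (machine_code M)"

lemma set_decode_trans: "set_decode T = transition_code ` transitions M"
  using finite_transitions[OF wf] by (simp add: trans_of_def machine_code_def)

text \<open>A pair code is at least as large as its components, and a set code exceeds its members.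
  So \<open>T\<close> bounds the channels in use, and a table of length \<open>Suc T\<close> can
  hold a reachable configuration.\<close>

lemma chan_less_trans: "t \<in> transitions M \<Longrightarrow> fst (act t) < T"
proof -
  assume "t \<in> transitions M"
  then have "transition_code t < T" using set_decode_trans set_decode_less by blast
  moreover have "fst (act t) \<le> transition_code t"
    by (cases t rule: transition_code.cases)
      (auto simp: act_def intro: le_trans[OF le_prod_encode_1 le_prod_encode_2])
  ultimately show ?thesis by simp
qed

lemma initc_conf: "initc (machine_code M) = conf_code T (initial_config M)"
  unfolding initc_def conf_code_def
  by (rule tab_cong) (simp add: initial_config_def start_of_def machine_code_def)

lemma proj_empty:
  assumes "set ts \<subseteq> transitions M" "T \<le> c"
  shows "send_proj c (map act ts) = []" "recv_proj c (map act ts) = []"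
proof -
  have "fst (act t) \<noteq> c" if "t \<in> set ts" for t
    using chan_less_trans[of t] assms that by auto
  then show "send_proj c (map act ts) = []" "recv_proj c (map act ts) = []"
    by (auto simp: send_proj_def recv_proj_def split: prod.splits) (metis fst_conv)+
qed

lemma reachable_support:
  assumes "steps M (initial_config M) \<sigma> s" "T \<le> c"
  shows "snd s c = []"
proof -
  from assms(1) obtain ts where "set ts \<subseteq> transitions M" "map act ts = \<sigma>"
    unfolding steps_iff_trun by blast
  then show ?thesis
    using steps_content[OF assms(1), of c] proj_empty[of ts c] assms(2) by (auto simp: initial_config_def)
qed

lemma validc_iff:
  "validc (machine_code M) z \<longleftrightarrow> (\<exists>ts. set ts \<subseteq> transitions M \<and> z = list_encode (map transition_code ts))"
proof -
  obtain xs where z: "z = list_encode xs" by (metis list_decode_inverse)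
  have "validc (machine_code M) z \<longleftrightarrow> xs \<in> lists (transition_code ` transitions M)"
    unfolding validc_def z set_decode_trans by (auto simp: in_lists_conv_set all_set_conv_all_nth)
  also have "\<dots> \<longleftrightarrow> (\<exists>ts. set ts \<subseteq> transitions M \<and> z = list_encode (map transition_code ts))"
    unfolding lists_image z by (auto simp: list_encode_eq lists_eq_set)
  finally show ?thesis .
qed

lemma runc_trans:
  "set ts \<subseteq> transitions M \<Longrightarrow>
   runc (conf_code T s) (list_encode (map transition_code ts)) = opt_code T (trun s ts)"
  using chan_less_trans by (intro runc_conf) blast

lemma loopc_iff:
  assumes ts: "set ts \<subseteq> transitions M" "trun s ts = Some s'"
  shows "loopc (machine_code M) (conf_code T s) (conf_code T s') (list_encode (map transition_code ts)) \<longleftrightarrow>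
    fst s = fst s' \<and> (\<forall>c. chan_loop (snd s c) (recv_proj c (map act ts)) (send_proj c (map act ts)))"
proof -
  have chans: "fst (act t) < T" if "t \<in> set ts" for t using chan_less_trans ts that by blast
  obtain q where q: "sendsc (conf_code T s) (list_encode (map transition_code ts)) =
      conf_code T (q, \<lambda>c. snd s c @ send_proj c (map act ts))"
    using sendsc_conf[of ts T s] chans by blast
  have run: "steps M s (map act ts) s'" unfolding steps_iff_trun using ts by blast
  have "chan_loop (snd s c) (recv_proj c (map act ts)) (send_proj c (map act ts))" if "T \<le> c" for c
    using proj_empty(2)[OF ts(1) that] by (simp add: chan_loop_def)
  then have all: "(\<forall>c. chan_loop (snd s c) (recv_proj c (map act ts)) (send_proj c (map act ts))) \<longleftrightarrow>
      (\<forall>c<T. chan_loop (snd s c) (recv_proj c (map act ts)) (send_proj c (map act ts)))"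
    by (meson not_le)
  show ?thesis
    unfolding loopc_def all q using chanc_iff[OF steps_content[OF run]] by auto
qed

lemma loop_cert_iff:
  "(\<exists>z. loop_cert b (machine_code M) z) \<longleftrightarrow>
   (\<exists>\<sigma>\<^sub>0 q w \<sigma> w'. steps M (initial_config M) \<sigma>\<^sub>0 (q, w) \<and> machine_loop M q w \<sigma> w' \<and> (b = 0 \<or> w \<noteq> w'))"
  (is "_ \<longleftrightarrow> ?R")
proof
  assume "\<exists>z. loop_cert b (machine_code M) z"
  then obtain z where z: "loop_cert b (machine_code M) z" ..
  then obtain ts\<^sub>0 ts where ts: "set ts\<^sub>0 \<subseteq> transitions M" "pfst z = list_encode (map transition_code ts\<^sub>0)"
    "set ts \<subseteq> transitions M" "psnd z = list_encode (map transition_code ts)"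
    unfolding loop_cert_def validc_iff by blast
  note runs = runc_trans[OF ts(1)] runc_trans[OF ts(3)]
  from z obtain s where s: "trun (initial_config M) ts\<^sub>0 = Some s"
    unfolding loop_cert_def ts initc_conf runs by (auto simp: opt_code_def split: option.splits)
  from z have "runc (conf_code T s) (list_encode (map transition_code ts)) \<noteq> 0"
    unfolding loop_cert_def ts initc_conf runs(1) s by simp
  then obtain s' where s': "trun s ts = Some s'" by (auto simp: runs(2))
  from z have "b = 0 \<or> conf_code T s \<noteq> conf_code T s'" "ts \<noteq> []"
    and "loopc (machine_code M) (conf_code T s) (conf_code T s') (list_encode (map transition_code ts))"
    unfolding loop_cert_def ts initc_conf runs s by (simp_all add: runs s')
  then have "b = 0 \<or> s \<noteq> s'" "ts \<noteq> []" "fst s = fst s'"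
    "\<forall>c. chan_loop (snd s c) (recv_proj c (map act ts)) (send_proj c (map act ts))"
    unfolding loopc_iff[OF ts(3) s'] by auto
  moreover have "steps M (initial_config M) (map act ts\<^sub>0) s" "steps M s (map act ts) s'"
    unfolding steps_iff_trun using ts s s' by blast+
  moreover obtain q w w' where "s = (q, w)" "s' = (q, w')" using \<open>fst s = fst s'\<close> by (metis prod.collapse)
  ultimately have "steps M (initial_config M) (map act ts\<^sub>0) (q, w)"
    "machine_loop M q w (map act ts) w'" "b = 0 \<or> w \<noteq> w'"
    unfolding machine_loop_def by simp_all
  then show ?R by blast
next
  assume ?R
  then obtain \<sigma>\<^sub>0 q w \<sigma> w' where run: "steps M (initial_config M) \<sigma>\<^sub>0 (q, w)"
    and loop: "steps M (q, w) \<sigma> (q, w')" "\<sigma> \<noteq> []"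
      "\<forall>c. chan_loop (w c) (recv_proj c \<sigma>) (send_proj c \<sigma>)"
    and b: "b = 0 \<or> w \<noteq> w'"
    unfolding machine_loop_def by blast
  from run obtain ts\<^sub>0 where ts0: "set ts\<^sub>0 \<subseteq> transitions M" "trun (initial_config M) ts\<^sub>0 = Some (q, w)"
    unfolding steps_iff_trun by blast
  from loop(1) obtain ts where ts: "set ts \<subseteq> transitions M" "trun (q, w) ts = Some (q, w')" "\<sigma> = map act ts"
    unfolding steps_iff_trun by blast
  let ?z = "prod_encode (list_encode (map transition_code ts\<^sub>0), list_encode (map transition_code ts))"
  note runs = runc_trans[OF ts0(1)] runc_trans[OF ts(1)]
  \<comment> \<open>Both configurations are reachable, hence empty on the channels from
    \<open>T\<close> on, where the code is blind.\<close>
  have "conf_code T (q, w) \<noteq> conf_code T (q, w')" if "w \<noteq> w'"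
  proof
    assume eq: "conf_code T (q, w) = conf_code T (q, w')"
    have "steps M (initial_config M) (\<sigma>\<^sub>0 @ \<sigma>) (q, w')" using run loop(1) steps_append by blast
    from conf_code_inject[OF eq] reachable_support[OF run] reachable_support[OF this] that
    show False by auto
  qed
  moreover have "loopc (machine_code M) (conf_code T (q, w)) (conf_code T (q, w')) (list_encode (map transition_code ts))"
    unfolding loopc_iff[OF ts(1,2)] using loop(3) ts(3) by simp
  moreover have "validc (machine_code M) (list_encode (map transition_code ts\<^sub>0))"
    "validc (machine_code M) (list_encode (map transition_code ts))"
    unfolding validc_iff using ts ts0 by blast+
  ultimately have "loop_cert b (machine_code M) ?z"
    unfolding loop_cert_def pfst_prod_encode psnd_prod_encode initc_conf
    using b loop(2) ts(2,3) ts0(2) by (auto simp: runs)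
  then show "\<exists>z. loop_cert b (machine_code M) z" ..
qed

lemma closure_cert_list_encode:
  "closure_cert \<delta> (machine_code M) (list_encode xs) \<longleftrightarrow>
   prod_encode (0, conf_code T (initial_config M)) \<in> set xs \<and>
   (\<forall>x\<in>set xs. \<forall>t\<in>transitions M. stepc (psnd x) (transition_code t) = 0 \<or>
      prod_encode (pfst x + \<delta>, stepc (psnd x) (transition_code t) - 1) \<in> set xs)"
proof -
  have ex: "(\<exists>k<lenc (list_encode xs). nthc (list_encode xs) k = v) \<longleftrightarrow> v \<in> set xs" for v
    by (auto simp: in_set_conv_nth)
  have trans: "(\<forall>t<T. t \<in> set_decode T \<longrightarrow> Q t) \<longleftrightarrow> (\<forall>t\<in>transitions M. Q (transition_code t))" for Q
  proof -
    have "(\<forall>t<T. t \<in> set_decode T \<longrightarrow> Q t) \<longleftrightarrow> (\<forall>t\<in>set_decode T. Q t)"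
      using set_decode_less[of _ T] by blast
    then show ?thesis unfolding set_decode_trans by simp
  qed
  show ?thesis unfolding closure_cert_def ex trans initc_conf by (simp add: all_set_conv_all_nth)
qed

lemma closure_cert_iff: "(\<exists>C. closure_cert \<delta> (machine_code M) C) \<longleftrightarrow> finite (ranked \<delta> M)"
proof
  let ?code = "\<lambda>(i, s). prod_encode (i, conf_code T s)"
  assume "\<exists>C. closure_cert \<delta> (machine_code M) C"
  then obtain xs where xs: "closure_cert \<delta> (machine_code M) (list_encode xs)"
    by (metis list_decode_inverse)
  \<comment> \<open>A certificate may contain numbers that code no configuration. Its preimage under
    \<open>?code\<close> is closed under steps all the same, and injectivity of \<open>?code\<close>
    on \<open>ranked \<delta> M\<close> then gives finiteness.\<close>
  have "ranked \<delta> M \<subseteq> {x. ?code x \<in> set xs}"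
  proof (rule ranked_subset)
    show "(0, initial_config M) \<in> {x. ?code x \<in> set xs}"
      using xs by (simp add: closure_cert_list_encode)
  next
    fix i s \<alpha> s'
    assume "(i, s) \<in> {x. ?code x \<in> set xs}" "step M s \<alpha> s'"
    then obtain t where t: "t \<in> transitions M" "tstep t s = Some s'"
      and s: "prod_encode (i, conf_code T s) \<in> set xs"
      unfolding step_iff_tstep by auto
    let ?x = "prod_encode (i, conf_code T s)"
    have "stepc (psnd ?x) (transition_code t) = 0 \<or>
        prod_encode (pfst ?x + \<delta>, stepc (psnd ?x) (transition_code t) - 1) \<in> set xs"
      using xs s t(1) unfolding closure_cert_list_encode by blast
    then show "(i + \<delta>, s') \<in> {x. ?code x \<in> set xs}"
      using stepc_conf[OF chan_less_trans[OF t(1)], of s] t(2) by simp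
  qed
  then have "?code ` ranked \<delta> M \<subseteq> set xs" by blast
  moreover have "inj_on ?code (ranked \<delta> M)"
    by (rule inj_onI) (auto simp: ranked_def dest!: conf_code_inject dest: reachable_support)
  ultimately show "finite (ranked \<delta> M)" by (meson finite_set inj_on_finite)
next
  let ?code = "\<lambda>(i, s). prod_encode (i, conf_code T s)"
  assume "finite (ranked \<delta> M)"
  then obtain ys where ys: "set ys = ranked \<delta> M" using finite_list by blast
  have "closure_cert \<delta> (machine_code M) (list_encode (map ?code ys))"
    unfolding closure_cert_list_encode set_map ys
  proof (intro conjI ballI)
    have "(0, initial_config M) \<in> ranked \<delta> M" using rankedI[OF steps.Nil, of \<delta> M] by simp
    then show "prod_encode (0, conf_code T (initial_config M)) \<in> ?code ` ranked \<delta> M"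
      by (rule rev_image_eqI) simp
  next
    fix x t assume "x \<in> ?code ` ranked \<delta> M" and t: "t \<in> transitions M"
    then obtain i s where mem: "(i, s) \<in> ranked \<delta> M" "x = prod_encode (i, conf_code T s)" by auto
    show "stepc (psnd x) (transition_code t) = 0 \<or>
        prod_encode (pfst x + \<delta>, stepc (psnd x) (transition_code t) - 1) \<in> ?code ` ranked \<delta> M"
    proof (cases "tstep t s")
      case (Some s')
      then have "step M s (act t) s'" unfolding step_iff_tstep using t by blast
      from ranked_closed[OF mem(1) this]
      have "prod_encode (i + \<delta>, conf_code T s') \<in> ?code ` ranked \<delta> M"
        by (rule rev_image_eqI) simp
      then show ?thesis
        using mem(2) Some stepc_conf[OF chan_less_trans[OF t], of s] by simp
    qed (simp add: mem(2) stepc_conf chan_less_trans[OF t])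
  qed
  then show "\<exists>C. closure_cert \<delta> (machine_code M) C" ..
qed

end

theorem theorem4p9:
  shows "decidable_on machine_code {M. wf_fifo_machine M \<and> input_bounded M} nonterminating \<and>
         decidable_on machine_code {M. wf_fifo_machine M \<and> input_bounded M} bounded_machine"
proof
  show "decidable_on machine_code {M. wf_fifo_machine M \<and> input_bounded M} nonterminating"
  proof (rule decidable_onI[OF dec_loop_cert[of 0] dec_closure_cert[of 1]])
    fix M :: "(nat, nat, nat) fifo_machine"
    assume "M \<in> {M. wf_fifo_machine M \<and> input_bounded M}"
    then show "nonterminating M \<longleftrightarrow> (\<exists>z. loop_cert 0 (machine_code M) z)"
      "\<not> nonterminating M \<longleftrightarrow> (\<exists>z. closure_cert 1 (machine_code M) z)"
      using nonterminating_iff_loop[of M] ranked_1[of M]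
      by (simp_all add: loop_cert_iff closure_cert_iff)
  qed
  show "decidable_on machine_code {M. wf_fifo_machine M \<and> input_bounded M} bounded_machine"
  \<comment> \<open>The roles are exchanged: a closure now certifies the positive answer, and a
    loop, which has to change the configuration, the negative one.\<close>
  proof (rule decidable_onI[OF dec_closure_cert[of 0] dec_loop_cert[of 1]])
    fix M :: "(nat, nat, nat) fifo_machine"
    assume "M \<in> {M. wf_fifo_machine M \<and> input_bounded M}"
    then show "bounded_machine M \<longleftrightarrow> (\<exists>z. closure_cert 0 (machine_code M) z)"
      "\<not> bounded_machine M \<longleftrightarrow> (\<exists>z. loop_cert 1 (machine_code M) z)"
      by (simp_all add: loop_cert_iff closure_cert_iff unbounded_iff_loop ranked_0)
  qed
qed

end
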